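(* Let $b>0$ and $A\in\mathcal O^0_e(-b,b)$. Let $F\in C^1(\mathbf H,\mathbb R)$ satisfy the following two conditions. (i) There is a constant $l_F<b$ such that $\|F'(z+h)-F'(z)\|_{\mathbf H}\le l_F\|h\|_{\mathbf H}$ for all $z,h\in\mathbf H$. (ii) There exist $M>0$ and $B_\infty\in\mathcal L_s(\mathbf H,-b,b)$ such that $F'(z)=B_\infty z+r(z)$ with $\|r(z)\|_{\mathbf H}\le M$ for all $z\in\mathbf H$, and either $$(r(z),z)_{\mathbf H}\to+\infty\quad\text{as }\|z\|_{\mathbf H}\to\infty,$$ or $$(r(z),z)_{\mathbf H}\to-\infty\quad\text{as }\|z\|_{\mathbf H}\to\infty.$$ Then the equation $Az=F'(z)$, $z\in D(A)$, has at least one solution.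
   Context: $\mathbf H$ is an infinite-dimensional separable Hilbert space with inner product $(\cdot,\cdot)_{\mathbf H}$; $F'$ denotes the gradient of $F$. For $b>0$, $\mathcal O^0_e(-b,b)$ is the set of (possibly unbounded) linear self-adjoint operators $A$ on $\mathbf H$, with domain $D(A)$, such that $\sigma_e(A)\cap(-b,b)=\emptyset$ and $\sigma(A)\cap(-b,b)\neq\emptyset$ ($\sigma_e$ is the essential spectrum). $\mathcal L_s(\mathbf H,-b,b)$ is the set of bounded self-adjoint operators $B$ on $\mathbf H$ with $-bI<B<bI$, where $B<bI$ means that $(b-\delta)I-B$ is positive definite for some $\delta>0$, and $B>-bI$ is understood similarly. *)

theory Defs
  imports "HOL-Analysis.Analysis"
begin

text \<open>
  A (possibly unbounded) operator on a real Hilbert space is given by its domain \<open>D\<close> and a total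
  function \<open>A\<close>; only the values of \<open>A\<close> on \<open>D\<close> are significant.
\<close>

definition linear_operator :: "'a::real_vector set \<Rightarrow> ('a \<Rightarrow> 'a) \<Rightarrow> bool" where
  "linear_operator D A \<longleftrightarrow>
     subspace D \<and>
     (\<forall>x\<in>D. \<forall>y\<in>D. A (x + y) = A x + A y) \<and>
     (\<forall>c. \<forall>x\<in>D. A (c *\<^sub>R x) = c *\<^sub>R A x)"

text \<open>The adjoint as a relation; it is single-valued exactly when the subspace \<open>D\<close> is dense.\<close>

definition adjoint_graph :: "'a::real_inner set \<Rightarrow> ('a \<Rightarrow> 'a) \<Rightarrow> ('a \<times> 'a) set" where
  "adjoint_graph D A = {(y, w). \<forall>x\<in>D. inner (A x) y = inner x w}"

definition self_adjoint :: "'a::real_inner set \<Rightarrow> ('a \<Rightarrow> 'a) \<Rightarrow> bool" where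
  "self_adjoint D A \<longleftrightarrow>
     linear_operator D A \<and> closure D = UNIV \<and>
     adjoint_graph D A = {(y, A y) |y. y \<in> D}"

text \<open>
  Spectra are subsets of \<open>\<real>\<close>; for a self-adjoint operator this is also the spectrum of its
  complexification.
\<close>

definition resolvent_set :: "'a::real_normed_vector set \<Rightarrow> ('a \<Rightarrow> 'a) \<Rightarrow> real set" where
  "resolvent_set D A =
     {\<mu>. bij_betw (\<lambda>x. A x - \<mu> *\<^sub>R x) D UNIV \<and>
         bounded_linear (inv_into D (\<lambda>x. A x - \<mu> *\<^sub>R x))}"

definition spectrum :: "'a::real_normed_vector set \<Rightarrow> ('a \<Rightarrow> 'a) \<Rightarrow> real set" where
  "spectrum D A = - resolvent_set D A"

definition finite_dimensional :: "'a::real_vector set \<Rightarrow> bool" where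
  "finite_dimensional V \<longleftrightarrow> (\<exists>S. finite S \<and> V \<subseteq> span S)"

definition eigenspace :: "'a::real_vector set \<Rightarrow> ('a \<Rightarrow> 'a) \<Rightarrow> real \<Rightarrow> 'a set" where
  "eigenspace D A \<mu> = {x \<in> D. A x = \<mu> *\<^sub>R x}"

text \<open>The discrete spectrum consists of the isolated eigenvalues of finite multiplicity.\<close>

definition discrete_spectrum :: "'a::real_normed_vector set \<Rightarrow> ('a \<Rightarrow> 'a) \<Rightarrow> real set" where
  "discrete_spectrum D A =
     {\<mu>. \<mu> isolated_in spectrum D A \<and>
         eigenspace D A \<mu> \<noteq> {0} \<and> finite_dimensional (eigenspace D A \<mu>)}"

definition essential_spectrum :: "'a::real_normed_vector set \<Rightarrow> ('a \<Rightarrow> 'a) \<Rightarrow> real set" where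
  "essential_spectrum D A = spectrum D A - discrete_spectrum D A"

text \<open>The class \<open>\<O>\<^sup>0\<^sub>e(-b, b)\<close>, as pairs of a domain and an operator.\<close>

definition O0e :: "real \<Rightarrow> ('a::real_inner set \<times> ('a \<Rightarrow> 'a)) set" where
  "O0e b =
     {(D, A). self_adjoint D A \<and>
        essential_spectrum D A \<inter> {-b<..<b} = {} \<and>
        spectrum D A \<inter> {-b<..<b} \<noteq> {}}"

definition positive_definite :: "('a::real_inner \<Rightarrow> 'a) \<Rightarrow> bool" where
  "positive_definite B \<longleftrightarrow> (\<forall>x. x \<noteq> 0 \<longrightarrow> inner (B x) x > 0)"

text \<open>The class \<open>\<L>\<^sub>s(\<^bold>H, -b, b)\<close>; the last two conjuncts are \<open>B < b I\<close> and \<open>B > -b I\<close>.\<close>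

definition L_s :: "real \<Rightarrow> ('a::real_inner \<Rightarrow> 'a) set" where
  "L_s b =
     {B. bounded_linear B \<and> self_adjoint UNIV B \<and>
        (\<exists>\<delta>>0. positive_definite (\<lambda>x. (b - \<delta>) *\<^sub>R x - B x)) \<and>
        (\<exists>\<delta>>0. positive_definite (\<lambda>x. B x - (- b + \<delta>) *\<^sub>R x))}"

end

theory Submission
  imports Defs "HOL-Homology.Brouwer_Degree"
begin

text \<open>
  Choose \<open>\<beta> < b\<close> above the Lipschitz constant of \<open>F'\<close> and the norm of \<open>B\<^sub>\<infinity>\<close>. Only finitely
  many points of the spectrum of \<open>A\<close> lie in \<open>[-\<beta>, \<beta>]\<close>, all of them eigenvalues of finite
  multiplicity, so a finite rank operator \<open>K\<close> pushes the spectrum out of that interval and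
  \<open>S = (A + K)\<inverse>\<close> has norm at most \<open>1 / \<beta>\<close>. The equation becomes
  \<open>z = S (F' z) + S (K z)\<close>, where \<open>S \<circ> F'\<close> is a contraction: solving \<open>z = S (F' z) + v\<close> for
  given \<open>v\<close> reduces the problem to \<open>v = S (K (z v))\<close> on the finite-dimensional range of
  \<open>S \<circ> K\<close>. This is deformed through \<open>s F' + (1 - s) (B\<^sub>\<infinity> \<plusminus> c)\<close> with small \<open>c > 0\<close> into an
  invertible linear problem; the sign condition on \<open>(r z, z)\<close> bounds the solutions along the
  deformation, and non-contractibility of spheres gives a zero.
\<close>

section \<open>Finite-dimensional subspaces\<close>

text \<open>The obstacle is resonance: \<open>A - B\<^sub>\<infinity>\<close> may have a nontrivial
  kernel, on which only the bounded term \<open>r\<close> acts, and the inverse of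
  \<open>A - \<mu>\<close> need not be compact, so a degree argument in the whole space is not at
  hand. Taking \<open>\<beta>\<close> strictly above both constants leaves an infinite-dimensional
  part that is solved exactly by contraction, and only a finite-dimensional unknown meets topology.
  The term \<open>c\<close> has the sign of \<open>(r z, z)\<close>. Tested with the kernel
  component, \<open>r\<close> and \<open>c\<close> then push the same way and cannot cancel, which
  is where the bound on solutions comes from. It has to be small for two reasons:
  \<open>S \<circ> (B\<^sub>\<infinity> \<plusminus> c)\<close> must stay a contraction, and the
  component orthogonal to the kernel must stay bounded. The spectral facts rest on quadratic forms
  rather than on a functional calculus: a gap between \<alpha> and \<gamma> makes
  \<open>(A - \<alpha>) (A - \<gamma>)\<close> nonnegative, and the Cauchy-Schwarz inequality for
  semidefinite forms turns such signs into resolvent bounds.\<close>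

definition orthonormal :: "'a::real_inner set \<Rightarrow> bool" where
  "orthonormal B \<longleftrightarrow> pairwise orthogonal B \<and> (\<forall>b\<in>B. norm b = 1)"

definition proj :: "'a::real_inner set \<Rightarrow> 'a \<Rightarrow> 'a" where
  "proj B x = (\<Sum>b\<in>B. inner x b *\<^sub>R b)"

lemma inner_orthonormal:
  assumes "orthonormal B" "a \<in> B" "b \<in> B"
  shows "inner a b = (if a = b then 1 else 0)"
  using assms by (auto simp: orthonormal_def pairwise_def orthogonal_def dot_square_norm)

lemma inner_sum_orthonormal:
  assumes "finite B" "orthonormal B" "b \<in> B"
  shows "inner (\<Sum>a\<in>B. c a *\<^sub>R a) b = c b"
proof -
  have "inner (\<Sum>a\<in>B. c a *\<^sub>R a) b = (\<Sum>a\<in>B. if a = b then c a else 0)"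
    unfolding inner_sum_left
    by (intro sum.cong) (auto simp: inner_orthonormal[OF assms(2) _ assms(3)])
  then show ?thesis using assms by simp
qed

lemma proj_in_span: "proj B x \<in> span B"
  unfolding proj_def by (intro span_sum span_scale span_base)

lemma inner_diff_proj:
  assumes "finite B" "orthonormal B" "y \<in> span B"
  shows "inner (x - proj B x) y = 0"
proof -
  have "orthogonal (x - proj B x) y"
    using assms by (intro orthogonal_to_span[OF assms(3)])
      (simp add: orthogonal_def inner_diff_left proj_def inner_sum_orthonormal)
  then show ?thesis by (simp add: orthogonal_def)
qed

lemma proj_id:
  assumes "finite B" "orthonormal B" "x \<in> span B"
  shows "proj B x = x"
proof -
  have "x - proj B x \<in> span B" using assms proj_in_span span_diff by blast
  from inner_diff_proj[OF assms(1,2) this, of x] show ?thesis by simp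
qed

lemma bounded_linear_proj: "bounded_linear (proj B)"
  unfolding proj_def [abs_def]
  by (intro bounded_linear_sum bounded_linear_scaleR_const bounded_linear_inner_left)

lemma proj_symmetric: "inner (proj B x) y = inner x (proj B y)"
  by (simp add: proj_def inner_sum_left inner_sum_right mult.commute inner_commute)

lemma finite_dimensional_orthonormal_basis:
  fixes V :: "'a::real_inner set"
  assumes "finite_dimensional V" "subspace V"
  obtains B where "finite B" "orthonormal B" "span B = V"
proof -
  obtain S where S: "finite S" "V \<subseteq> span S" using assms by (auto simp: finite_dimensional_def)
  obtain T where T: "T \<subseteq> V" "independent T" "V \<subseteq> span T"
    by (meson maximal_independent_subset)
  then have fin: "finite T" using independent_span_bound[OF S(1) T(2)] S by auto
  have "span T = V" using T assms(2) by (meson span_minimal subset_antisym)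
  moreover obtain C where C: "finite C" "span C = span T" "pairwise orthogonal C"
    using basis_orthogonal[OF fin] by blast
  define B where "B = (\<lambda>c. c /\<^sub>R norm c) ` (C - {0})"
  have "orthonormal B"
    unfolding orthonormal_def pairwise_def
  proof (intro conjI ballI impI)
    fix x y assume "x \<in> B" "y \<in> B" "x \<noteq> y"
    then obtain c d where "c \<in> C" "d \<in> C" "x = c /\<^sub>R norm c" "y = d /\<^sub>R norm d" "c \<noteq> d"
      by (auto simp: B_def)
    then show "orthogonal x y" using C(3) by (simp add: pairwise_def orthogonal_def)
  next
    fix x assume "x \<in> B"
    then show "norm x = 1" unfolding B_def by (auto simp del: real_scaleR_def) (metis left_inverse norm_eq_zero)
  qed
  moreover have "span B = span C"
  proof
    have "B \<subseteq> span C" by (auto simp: B_def intro: span_scale span_base)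
    then show "span B \<subseteq> span C" using span_minimal by blast
    have "c \<in> span B" if "c \<in> C" for c
    proof (cases "c = 0")
      case False
      then have "norm c *\<^sub>R (c /\<^sub>R norm c) \<in> span B"
        using that by (intro span_scale span_base) (auto simp: B_def)
      then show ?thesis using False by simp
    qed (simp add: span_zero)
    then show "span C \<subseteq> span B" using span_minimal[of C "span B"] by auto
  qed
  ultimately show ?thesis using C that[of B] by (auto simp: B_def)
qed

text \<open>Replaces Heine-Borel inside an infinite-dimensional space: the set is a Minkowski sum of
  finitely many segments.\<close>

lemma compact_bounded_combinations:
  fixes B :: "'a::real_normed_vector set"
  assumes "finite B"
  shows "compact {\<Sum>b\<in>B. c b *\<^sub>R b |c. \<forall>b\<in>B. \<bar>c b\<bar> \<le> M}"
  using assms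
proof (induction B)
  case (insert a B)
  let ?K = "{\<Sum>b\<in>B. c b *\<^sub>R b |c. \<forall>b\<in>B. \<bar>c b\<bar> \<le> M}"
  have "compact ((\<lambda>t. t *\<^sub>R a) ` {-M..M})"
    by (intro compact_continuous_image continuous_intros) simp
  then have "compact {x + y |x y. x \<in> (\<lambda>t. t *\<^sub>R a) ` {-M..M} \<and> y \<in> ?K}"
    using insert.IH by (rule compact_sums)
  also have "{x + y |x y. x \<in> (\<lambda>t. t *\<^sub>R a) ` {-M..M} \<and> y \<in> ?K} =
      {\<Sum>b\<in>insert a B. c b *\<^sub>R b |c. \<forall>b\<in>insert a B. \<bar>c b\<bar> \<le> M}" (is "?L = ?R")
  proof
    show "?L \<subseteq> ?R"
    proof
      fix z assume "z \<in> ?L"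
      then obtain t c where z: "z = t *\<^sub>R a + (\<Sum>b\<in>B. c b *\<^sub>R b)" "\<bar>t\<bar> \<le> M" "\<forall>b\<in>B. \<bar>c b\<bar> \<le> M"
        by (fastforce simp: abs_le_iff)
      have "(\<Sum>b\<in>B. c b *\<^sub>R b) = (\<Sum>b\<in>B. (c(a := t)) b *\<^sub>R b)"
        using insert.hyps by (intro sum.cong) auto
      then have "z = (\<Sum>b\<in>insert a B. (c(a := t)) b *\<^sub>R b)"
        using z insert.hyps by simp
      moreover have "\<forall>b\<in>insert a B. \<bar>(c(a := t)) b\<bar> \<le> M" using z by simp
      ultimately show "z \<in> ?R" by blast
    qed
    show "?R \<subseteq> ?L"
    proof
      fix z assume "z \<in> ?R"
      then obtain c where c: "z = (\<Sum>b\<in>insert a B. c b *\<^sub>R b)" "\<forall>b\<in>insert a B. \<bar>c b\<bar> \<le> M" by blast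
      then have "z = c a *\<^sub>R a + (\<Sum>b\<in>B. c b *\<^sub>R b)" using insert.hyps by simp
      moreover have "c a \<in> {-M..M}" using c by (auto simp: abs_le_iff)
      ultimately show "z \<in> ?L" using c(2) by blast
    qed
  qed
  finally show ?case .
qed simp

lemma bounded_seq_in_span_convergent_subseq:
  fixes u :: "nat \<Rightarrow> 'a::real_inner"
  assumes B: "finite B" "orthonormal B" and u: "\<And>n. u n \<in> span B" "\<And>n. norm (u n) \<le> M"
  obtains l r where "strict_mono r" "(u \<circ> r) \<longlonglongrightarrow> l"
proof -
  have "u n \<in> {\<Sum>b\<in>B. c b *\<^sub>R b |c. \<forall>b\<in>B. \<bar>c b\<bar> \<le> M}" for n
  proof -
    have "u n = (\<Sum>b\<in>B. inner (u n) b *\<^sub>R b)"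
      using proj_id[OF B u(1)] by (simp add: proj_def)
    moreover have "\<forall>b\<in>B. \<bar>inner (u n) b\<bar> \<le> M"
    proof
      fix b assume "b \<in> B"
      then have "norm b = 1" using B by (auto simp: orthonormal_def)
      then show "\<bar>inner (u n) b\<bar> \<le> M"
        using Cauchy_Schwarz_ineq2[of "u n" b] u(2)[of n] by simp
    qed
    ultimately show ?thesis by blast
  qed
  then have "\<exists>l\<in>{\<Sum>b\<in>B. c b *\<^sub>R b |c. \<forall>b\<in>B. \<bar>c b\<bar> \<le> M}. \<exists>r. strict_mono r \<and> (u \<circ> r) \<longlonglongrightarrow> l"
    by (intro mp[OF spec[OF compact_bounded_combinations[OF B(1), of M, unfolded compact_def]]] allI)
  then show ?thesis using that by blast
qed

text \<open>Dimension count: a missed vector together with the image of a basis would be one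
  independent vector too many.\<close>

lemma linear_inj_on_imp_surj_on_span:
  fixes f :: "'a::real_vector \<Rightarrow> 'a"
  assumes B: "finite B" and f: "linear f" "f ` span B \<subseteq> span B" "inj_on f (span B)"
  shows "f ` span B = span B"
proof (rule ccontr)
  assume "f ` span B \<noteq> span B"
  then obtain y where y: "y \<in> span B" "y \<notin> f ` span B" using f by blast
  obtain C where C: "C \<subseteq> span B" "independent C" "span B \<subseteq> span C"
    by (meson maximal_independent_subset)
  have finC: "finite C" using independent_span_bound[OF B C(2,1)] by simp
  have spanC: "span C = span B" using C by (meson span_minimal subset_antisym subspace_span)
  have indep: "independent (f ` C)"
    using linear_independent_injective_image[OF f(1) C(2)] f(3) spanC by simp
  have "span (f ` C) = f ` span B" using linear_span_image[OF f(1), of C] spanC by simp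
  then have y': "y \<notin> span (f ` C)" using y by simp
  then have "independent (insert y (f ` C))" using indep by (simp add: independent_insert)
  moreover have "insert y (f ` C) \<subseteq> span C" using y f(2) C(1) spanC by auto
  ultimately have "card (insert y (f ` C)) \<le> card C" using independent_span_bound[OF finC] by blast
  moreover have "card (f ` C) = card C"
    by (rule card_image) (rule inj_on_subset[OF f(3) C(1)])
  moreover have "card (insert y (f ` C)) = Suc (card (f ` C))"
    using y' span_base[of y "f ` C"] finC by (intro card_insert_disjoint) auto
  ultimately show False by linarith
qed

lemma finite_dimensional_inj_on_preimage:
  fixes f :: "'a::real_vector \<Rightarrow> 'a"
  assumes "linear f" "subspace N" "inj_on f N" "finite_dimensional (f ` N)"
  shows "finite_dimensional N"
proof -
  obtain S where S: "finite S" "f ` N \<subseteq> span S" using assms by (auto simp: finite_dimensional_def)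
  obtain g where g: "linear g" "\<forall>v\<in>N. g (f v) = v"
    using linear_exists_left_inverse_on[OF assms(1-3)] by auto
  have "N \<subseteq> g ` span S"
  proof
    fix x assume "x \<in> N"
    then have "x = g (f x)" "f x \<in> span S" using S g by auto
    then show "x \<in> g ` span S" by (rule image_eqI)
  qed
  then have "N \<subseteq> span (g ` S)" using linear_span_image[OF g(1), of S] by simp
  then show ?thesis using S(1) by (auto simp: finite_dimensional_def)
qed

section \<open>A zero by deformation from the identity\<close>

lemma continuous_map_scaleR:
  fixes g :: "'b \<Rightarrow> 'a::real_normed_vector"
  assumes "continuous_map X euclideanreal f" "continuous_map X euclidean g"
  shows "continuous_map X euclidean (\<lambda>x. f x *\<^sub>R g x)"
  using assms by (simp add: continuous_map_atin tendsto_scaleR)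

text \<open>After normalisation, \<open>H\<close> connects the identity of the sphere of radius
  \<open>R\<close> with \<open>H 1\<close>. If \<open>H 1\<close> had no zero in the span, shrinking
  the radius would connect \<open>H 1\<close> with a constant, and the sphere would be
  contractible.\<close>

lemma homotopy_from_id_has_zero:
  fixes H :: "real \<Rightarrow> 'a::real_inner \<Rightarrow> 'a"
  assumes B: "finite B" "orthonormal B"
    and cont: "continuous_on ({0..1} \<times> span B) (\<lambda>(t, v). H t v)"
    and H: "\<And>t v. t \<in> {0..1} \<Longrightarrow> v \<in> span B \<Longrightarrow> H t v \<in> span B"
    and id: "\<And>v. v \<in> span B \<Longrightarrow> H 0 v = v"
    and R: "R > 0"
    and nz: "\<And>t v. t \<in> {0..1} \<Longrightarrow> v \<in> span B \<Longrightarrow> norm v = R \<Longrightarrow> H t v \<noteq> 0"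
  shows "\<exists>v\<in>span B. H 1 v = 0"
proof (rule ccontr)
  assume no_zero: "\<not> ?thesis"
  have "B \<noteq> {}"
  proof
    assume "B = {}"
    then have "H 1 0 = 0" using H[of 1 0] by simp
    with no_zero show False using span_zero by blast
  qed
  then obtain n where n: "card B = Suc n" using B(1) by (metis card_0_eq not0_implies_Suc)
  obtain e where e: "bij_betw e {..n} B"
    using ex_bij_betw_nat_finite[OF B(1)] n by (metis atLeast0LessThan lessThan_Suc_atMost)
  \<comment> \<open>\<open>E\<close> carries the coordinate sphere into the span, and
    \<open>N\<close> normalises and reads off coordinates. The sphere in
    \<open>n + 1 = card B\<close> coordinates is \<open>nsphere n\<close>, whose points vanish
    beyond index \<open>n\<close>; hence the default value 0 in \<open>N\<close>.\<close>
  define E where "E x = (\<Sum>i\<le>n. x i *\<^sub>R e i)" for x :: "nat \<Rightarrow> real"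
  define N where "N v i = (if i \<le> n then inner (v /\<^sub>R norm v) (e i) else 0)" for v :: 'a and i
  have eB: "e i \<in> B" if "i \<le> n" for i using e that by (auto simp: bij_betw_def)
  have e_inner: "inner (e i) (e j) = (if i = j then 1 else 0)" if "i \<le> n" "j \<le> n" for i j
  proof -
    have "e i = e j \<longleftrightarrow> i = j" using e that by (auto simp: bij_betw_def inj_on_def)
    then show ?thesis using inner_orthonormal[OF B(2) eB eB] that by simp
  qed
  have E_span: "E x \<in> span B" for x
    unfolding E_def by (intro span_sum span_scale span_base eB) simp
  have E_coord: "inner (E x) (e i) = x i" if "i \<le> n" for x i
  proof -
    have "inner (E x) (e i) = (\<Sum>j\<le>n. if j = i then x j else 0)"
      unfolding E_def inner_sum_left by (intro sum.cong) (auto simp: e_inner that)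
    then show ?thesis using that by simp
  qed
  have E_norm: "norm (E x) = 1" if "x \<in> topspace (nsphere n)" for x
  proof -
    have "inner (E x) (E x) = (\<Sum>i\<le>n. x i * inner (E x) (e i))"
      by (subst (2) E_def) (simp add: inner_sum_right)
    also have "\<dots> = (\<Sum>i\<le>n. (x i)\<^sup>2)" by (simp add: E_coord power2_eq_square)
    also have "\<dots> = 1" using that by (simp add: nsphere)
    finally show ?thesis by (simp add: norm_eq_1)
  qed
  have span_expand: "(\<Sum>i\<le>n. (inner v (e i))\<^sup>2) = (norm v)\<^sup>2" if "v \<in> span B" for v
  proof -
    have "inner v v = inner v (proj B v)" using proj_id[OF B that] by simp
    also have "\<dots> = (\<Sum>b\<in>B. (inner v b)\<^sup>2)"
      by (simp add: proj_def inner_sum_right power2_eq_square)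
    also have "\<dots> = (\<Sum>i\<le>n. (inner v (e i))\<^sup>2)"
      by (rule sum.reindex_bij_betw[OF e, symmetric])
    finally show ?thesis by (simp add: power2_norm_eq_inner)
  qed
  have E_cont: "continuous_map (nsphere n) euclidean E"
    unfolding E_def [abs_def]
    by (intro continuous_map_sum continuous_map_scaleR continuous_map_nsphere_projection) auto
  let ?I = "top_of_set {0..1::real}"
  \<comment> \<open>A continuous map into the span without zeros normalises to a continuous map into
    the sphere; both homotopies below are instances.\<close>
  have key: "continuous_map (prod_topology ?I (nsphere n)) (nsphere n) (\<lambda>(t, x). N (h (t, x)))"
    if h: "continuous_map (prod_topology ?I (nsphere n)) euclidean h"
      "\<And>t x. t \<in> {0..1} \<Longrightarrow> x \<in> topspace (nsphere n) \<Longrightarrow> h (t, x) \<in> span B \<and> h (t, x) \<noteq> 0"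
    for h
  proof -
    have coord: "continuous_map (prod_topology ?I (nsphere n)) euclideanreal (\<lambda>p. N (h p) i)" for i
    proof (cases "i \<le> n")
      case True
      have "continuous_map (prod_topology ?I (nsphere n)) (top_of_set (- {0})) h"
        using h by (auto simp: continuous_map_in_subtopology)
      moreover have "continuous_map (top_of_set (- {0})) euclideanreal (\<lambda>v. inner (v /\<^sub>R norm v) (e i))"
        by (auto intro!: continuous_intros)
      ultimately show ?thesis
        using True continuous_map_compose[of _ _ h _ "\<lambda>v. inner (v /\<^sub>R norm v) (e i)"]
        by (simp add: N_def o_def)
    qed (simp add: N_def)
    have "(\<Sum>i\<le>n. (N (h (t, x)) i)\<^sup>2) = 1"
      if "t \<in> {0..1}" "x \<in> topspace (nsphere n)" for t x
    proof -
      have "h (t, x) /\<^sub>R norm (h (t, x)) \<in> span B" using h(2)[OF that] by (intro span_scale) simp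
      from span_expand[OF this] show ?thesis using h(2)[OF that] by (simp add: N_def)
    qed
    then show ?thesis
      using coord
      by (auto simp: nsphere continuous_map_in_subtopology continuous_map_componentwise_UNIV
          case_prod_unfold N_def)
  qed
  have N_E: "N (R *\<^sub>R E x) = x" if "x \<in> topspace (nsphere n)" for x
  proof
    fix i
    have "norm (E x) = 1" by (rule E_norm[OF that])
    then show "N (R *\<^sub>R E x) i = x i"
      using R that by (auto simp: N_def E_coord nsphere)
  qed
  have comp: "continuous_map (prod_topology ?I (nsphere n)) euclidean (\<lambda>p. H (f p) (g p))"
    if "continuous_map (prod_topology ?I (nsphere n)) (top_of_set {0..1}) f"
       "continuous_map (prod_topology ?I (nsphere n)) (top_of_set (span B)) g" for f g
  proof -
    have "continuous_map (prod_topology ?I (nsphere n)) (top_of_set ({0..1} \<times> span B)) (\<lambda>p. (f p, g p))"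
      using that unfolding continuous_map_in_subtopology
      by (auto simp: continuous_map_atin intro!: tendsto_Pair)
    moreover have "continuous_map (top_of_set ({0..1} \<times> span B)) euclidean (\<lambda>(t, v). H t v)"
      using cont by simp
    ultimately show ?thesis
      using continuous_map_compose[of _ _ "\<lambda>p. (f p, g p)" _ "\<lambda>(t, v). H t v"] by (simp add: o_def)
  qed
  have fst_cont: "continuous_map (prod_topology ?I (nsphere n)) ?I fst"
    by (rule continuous_map_fst)
  have E_snd: "continuous_map (prod_topology ?I (nsphere n)) euclidean (\<lambda>p. E (snd p))"
    using continuous_map_compose[OF continuous_map_snd E_cont] by (simp add: o_def)
  have "homotopic_with (\<lambda>x. True) (nsphere n) (nsphere n) id (\<lambda>x. N (H 1 (R *\<^sub>R E x)))"
  proof -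
    have "continuous_map (prod_topology ?I (nsphere n)) euclidean (\<lambda>p. H (fst p) (R *\<^sub>R E (snd p)))"
      using fst_cont E_snd
      by (intro comp) (auto simp: continuous_map_in_subtopology E_span span_scale intro!: continuous_map_scaleR)
    then have "continuous_map (prod_topology ?I (nsphere n)) (nsphere n)
        (\<lambda>(t, x). N ((\<lambda>p. H (fst p) (R *\<^sub>R E (snd p))) (t, x)))"
    proof (rule key)
      fix t :: real and x assume tx: "t \<in> {0..1}" "x \<in> topspace (nsphere n)"
      have "R *\<^sub>R E x \<in> span B" using E_span span_scale by blast
      moreover have "norm (R *\<^sub>R E x) = R" using R E_norm[OF tx(2)] by simp
      ultimately show "H (fst (t, x)) (R *\<^sub>R E (snd (t, x))) \<in> span B \<and> H (fst (t, x)) (R *\<^sub>R E (snd (t, x))) \<noteq> 0"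
        using nz H tx(1) by simp
    qed
    then show ?thesis
      by (subst homotopic_with, simp)
        (intro exI[of _ "\<lambda>(t, x). N (H t (R *\<^sub>R E x))"], auto simp: id N_E E_span span_scale)
  qed
  \<comment> \<open>The radii sweep out the whole ball, so here the absence of zeros must come from
    \<open>no_zero\<close>; \<open>nz\<close> covers only the sphere.\<close>
  moreover have "homotopic_with (\<lambda>x. True) (nsphere n) (nsphere n) (\<lambda>x. N (H 1 0)) (\<lambda>x. N (H 1 (R *\<^sub>R E x)))"
  proof -
    have fst_real: "continuous_map (prod_topology ?I (nsphere n)) euclideanreal fst"
      using fst_cont by (simp add: continuous_map_in_subtopology)
    have "continuous_map (prod_topology ?I (nsphere n)) euclidean (\<lambda>p. H 1 (fst p *\<^sub>R R *\<^sub>R E (snd p)))"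
      using fst_real E_snd
      by (intro comp) (auto simp: continuous_map_in_subtopology E_span span_scale intro!: continuous_map_scaleR continuous_map_real_mult)
    then have "continuous_map (prod_topology ?I (nsphere n)) (nsphere n)
        (\<lambda>(t, x). N ((\<lambda>p. H 1 (fst p *\<^sub>R R *\<^sub>R E (snd p))) (t, x)))"
    proof (rule key)
      fix t :: real and x :: "nat \<Rightarrow> real"
      have "t *\<^sub>R R *\<^sub>R E x \<in> span B" using E_span span_scale by blast
      then show "H 1 (fst (t, x) *\<^sub>R R *\<^sub>R E (snd (t, x))) \<in> span B \<and>
          H 1 (fst (t, x) *\<^sub>R R *\<^sub>R E (snd (t, x))) \<noteq> 0"
        using no_zero H[of 1] by simp
    qed
    then show ?thesis
      unfolding homotopic_with_def
      by (intro exI[of _ "\<lambda>(t, x). N (H 1 (t *\<^sub>R R *\<^sub>R E x))"]) auto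
  qed
  ultimately have "contractible_space (nsphere n)"
    unfolding contractible_space_def by (meson homotopic_with_symD homotopic_with_trans)
  then show False using non_contractible_space_nsphere by blast
qed

section \<open>Isolated points of the spectrum of a self-adjoint operator\<close>

lemma self_adjoint_linear: "self_adjoint D A \<Longrightarrow> linear_operator D A"
  by (simp add: self_adjoint_def)

lemma linear_operator_diff:
  assumes "linear_operator D A" "x \<in> D" "y \<in> D"
  shows "A (x - y) = A x - A y"
proof -
  have "(-1) *\<^sub>R y \<in> D" using assms subspace_scale unfolding linear_operator_def by blast
  then have "A (x + (-1) *\<^sub>R y) = A x + A ((-1) *\<^sub>R y)" "A ((-1) *\<^sub>R y) = (-1) *\<^sub>R A y"
    using assms unfolding linear_operator_def by blast+
  then show ?thesis by simp
qed

lemma linear_operator_subspace: "linear_operator D A \<Longrightarrow> subspace D"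
  by (simp add: linear_operator_def)

lemma self_adjoint_symmetric:
  assumes "self_adjoint D A" "x \<in> D" "y \<in> D"
  shows "inner (A x) y = inner x (A y)"
proof -
  have "(y, A y) \<in> adjoint_graph D A" using assms by (auto simp: self_adjoint_def)
  then show ?thesis using assms(2) by (simp add: adjoint_graph_def)
qed

lemma resolvent_setE:
  assumes "\<mu> \<in> resolvent_set D A"
  obtains S where "bounded_linear S" "\<And>y. S y \<in> D" "\<And>y. A (S y) - \<mu> *\<^sub>R S y = y"
    "\<And>x. x \<in> D \<Longrightarrow> S (A x - \<mu> *\<^sub>R x) = x"
proof -
  let ?T = "\<lambda>x. A x - \<mu> *\<^sub>R x"
  have T: "bij_betw ?T D UNIV" "bounded_linear (inv_into D ?T)"
    using assms by (auto simp: resolvent_set_def)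
  then have ran: "?T ` D = UNIV" by (simp add: bij_betw_def)
  show ?thesis
  proof (rule that[OF T(2)])
    show "inv_into D ?T y \<in> D" for y using ran by (intro inv_into_into) auto
    show "A (inv_into D ?T y) - \<mu> *\<^sub>R inv_into D ?T y = y" for y
      using f_inv_into_f[of y ?T D] ran by auto
    show "inv_into D ?T (?T x) = x" if "x \<in> D" for x
      using T(1) that by (intro inv_into_f_f) (auto simp: bij_betw_def)
  qed
qed

lemma resolvent_setI:
  assumes lin: "linear_operator D A" and c: "c > 0"
    and lower: "\<And>x. x \<in> D \<Longrightarrow> c * norm x \<le> norm (A x - \<mu> *\<^sub>R x)"
    and surj: "\<And>y. \<exists>x\<in>D. A x - \<mu> *\<^sub>R x = y"
  shows "\<mu> \<in> resolvent_set D A"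
proof -
  let ?T = "\<lambda>x. A x - \<mu> *\<^sub>R x"
  note sub = linear_operator_subspace[OF lin]
  have inj: "inj_on ?T D"
  proof (rule inj_onI)
    fix x y assume xy: "x \<in> D" "y \<in> D" "?T x = ?T y"
    then have "?T (x - y) = 0" by (simp add: linear_operator_diff[OF lin] algebra_simps)
    then have "c * norm (x - y) \<le> 0" using lower[of "x - y"] subspace_diff[OF sub] xy by simp
    then show "x = y" using c by (simp add: mult_le_0_iff)
  qed
  have ran: "?T ` D = UNIV" 
  proof (rule UNIV_eq_I[symmetric])
    fix y
    obtain x where "x \<in> D" "y = ?T x" using surj by metis
    then show "y \<in> ?T ` D" by (intro image_eqI)
  qed
  define S where "S = inv_into D ?T"
  have S: "S y \<in> D" "?T (S y) = y" for y
    using ran unfolding S_def by (auto intro: inv_into_into f_inv_into_f[of y ?T D])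
  have S_eq: "S y = x" if "x \<in> D" "?T x = y" for x y
    using inv_into_f_f[OF inj that(1)] that(2) by (simp add: S_def)
  have "bounded_linear S"
  proof (rule bounded_linear_intro)
    show "S (x + y) = S x + S y" for x y
    proof (rule S_eq)
      have "A (S x + S y) = A (S x) + A (S y)" using lin S(1) by (simp add: linear_operator_def)
      then show "?T (S x + S y) = x + y" using S(2)[of x] S(2)[of y] by (simp add: algebra_simps)
    qed (intro subspace_add[OF sub] S)
    show "S (r *\<^sub>R x) = r *\<^sub>R S x" for r x
    proof (rule S_eq)
      have "A (r *\<^sub>R S x) = r *\<^sub>R A (S x)" using lin S(1) by (simp add: linear_operator_def)
      then have "?T (r *\<^sub>R S x) = r *\<^sub>R ?T (S x)" by (simp add: algebra_simps)
      then show "?T (r *\<^sub>R S x) = r *\<^sub>R x" by (simp only: S(2))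
    qed (intro subspace_scale[OF sub] S)
    show "norm (S x) \<le> norm x * (1 / c)" for x
      using lower[OF S(1), of x] S(2)[of x] c by (simp add: field_simps)
  qed
  then show ?thesis using inj ran by (simp add: resolvent_set_def bij_betw_def S_def)
qed

lemma resolvent_lower_bound:
  assumes "\<mu> \<in> resolvent_set D A"
  obtains c where "c > 0" "\<And>x. x \<in> D \<Longrightarrow> c * norm x \<le> norm (A x - \<mu> *\<^sub>R x)"
proof -
  obtain S where S: "bounded_linear S" "\<And>x. x \<in> D \<Longrightarrow> S (A x - \<mu> *\<^sub>R x) = x"
    using resolvent_setE[OF assms] by metis
  obtain k where k: "k > 0" "\<And>y. norm (S y) \<le> norm y * k"
    using bounded_linear.pos_bounded[OF S(1)] by blast
  show ?thesis
  proof (rule that[of "1 / k"])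
    show "1 / k * norm x \<le> norm (A x - \<mu> *\<^sub>R x)" if "x \<in> D" for x
      using k(2)[of "A x - \<mu> *\<^sub>R x"] S(2)[OF that] k(1) by (simp add: field_simps)
  qed (use k in simp)
qed

text \<open>With \<open>S\<close> the inverse at \<mu>, solving at \<nu> means
  \<open>x = S (y + (\<nu> - \<mu>) x)\<close>, a contraction with factor
  \<open>\<bar>\<nu> - \<mu>\<bar> / d\<close>. The explicit radius \<open>d\<close> matters later,
  when a point is reached from a neighbour at a controlled distance.\<close>

lemma resolvent_set_perturb:
  fixes A :: "'a::{real_inner, complete_space} \<Rightarrow> 'a"
  assumes lin: "linear_operator D A" and \<mu>: "\<mu> \<in> resolvent_set D A"
    and lower: "\<And>x. x \<in> D \<Longrightarrow> d * norm x \<le> norm (A x - \<mu> *\<^sub>R x)"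
    and \<nu>: "\<bar>\<nu> - \<mu>\<bar> < d"
  shows "\<nu> \<in> resolvent_set D A"
proof -
  have d: "d > 0" using \<nu> by linarith
  obtain S where S: "bounded_linear S" "\<And>y. S y \<in> D" "\<And>y. A (S y) - \<mu> *\<^sub>R S y = y"
    using resolvent_setE[OF \<mu>] by metis
  have S_norm: "norm (S y) \<le> norm y / d" for y
    using lower[OF S(2), of y] S(3)[of y] d by (simp add: field_simps)
  show ?thesis
  proof (rule resolvent_setI[OF lin])
    show "0 < d - \<bar>\<nu> - \<mu>\<bar>" using \<nu> by simp
    show "(d - \<bar>\<nu> - \<mu>\<bar>) * norm x \<le> norm (A x - \<nu> *\<^sub>R x)" if "x \<in> D" for x
    proof -
      have "norm (A x - \<mu> *\<^sub>R x) \<le> norm (A x - \<nu> *\<^sub>R x) + norm ((\<nu> - \<mu>) *\<^sub>R x)"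
        using norm_triangle_ineq[of "A x - \<nu> *\<^sub>R x" "(\<nu> - \<mu>) *\<^sub>R x"] by (simp add: algebra_simps)
      then show ?thesis using lower[OF that] unfolding norm_scaleR left_diff_distrib by linarith
    qed
    show "\<exists>x\<in>D. A x - \<nu> *\<^sub>R x = y" for y
    proof -
      have "\<exists>!x. S (y + (\<nu> - \<mu>) *\<^sub>R x) = x"
      proof (rule banach_fix_type[of "\<bar>\<nu> - \<mu>\<bar> / d"]; (intro allI)?)
        fix u v
        have "S (y + (\<nu> - \<mu>) *\<^sub>R u) - S (y + (\<nu> - \<mu>) *\<^sub>R v) = S ((\<nu> - \<mu>) *\<^sub>R (u - v))"
          by (simp add: linear_diff[OF bounded_linear.linear[OF S(1)], symmetric] scaleR_diff_right)
        then show "dist (S (y + (\<nu> - \<mu>) *\<^sub>R u)) (S (y + (\<nu> - \<mu>) *\<^sub>R v)) \<le> \<bar>\<nu> - \<mu>\<bar> / d * dist u v"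
          using S_norm[of "(\<nu> - \<mu>) *\<^sub>R (u - v)"] by (simp add: dist_norm)
      qed (use \<nu> d in auto)
      then obtain x where x: "S (y + (\<nu> - \<mu>) *\<^sub>R x) = x" by blast
      then have "x \<in> D" "A x - \<mu> *\<^sub>R x = y + (\<nu> - \<mu>) *\<^sub>R x" using S(2,3) by metis+
      then show ?thesis by (intro bexI[of _ x]) (simp_all add: algebra_simps)
    qed
  qed
qed

section \<open>Quadratic forms and gaps in the spectrum\<close>

lemma Cauchy_Schwarz_semidefinite:
  fixes C :: "'a::real_inner \<Rightarrow> 'a"
  assumes "linear C" and sym: "\<And>x y. inner (C x) y = inner x (C y)"
    and pos: "\<And>x. inner (C x) x \<ge> 0"
  shows "(inner (C x) y)\<^sup>2 \<le> inner (C x) x * inner (C y) y"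
proof -
  define p q r where "p = inner (C x) x" and "q = inner (C x) y" and "r = inner (C y) y"
  have *: "p + 2 * t * q + t\<^sup>2 * r \<ge> 0" for t
  proof -
    have "inner (C y) x = q" using sym[of y x] by (simp add: q_def inner_commute)
    then have "inner (C (x + t *\<^sub>R y)) (x + t *\<^sub>R y) = p + 2 * t * q + t\<^sup>2 * r"
      using assms(1) by (simp add: linear_add linear_scale inner_left_distrib inner_right_distrib
          p_def q_def r_def power2_eq_square algebra_simps)
    then show ?thesis using pos by metis
  qed
  have "r \<ge> 0" "p \<ge> 0" using pos by (auto simp: r_def p_def)
  have "q\<^sup>2 \<le> p * r"
  proof (cases "r = 0")
    case True
    have "q = 0"
    proof (rule ccontr)
      assume "q \<noteq> 0"
      \<comment> \<open>This \<open>t\<close> gives \<open>p + 2 * t * q = -1\<close>: a nonconstant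
        affine function cannot stay nonnegative.\<close>
      then show False using *[of "-(p + 1) / (2 * q)"] True by (simp add: field_simps)
    qed
    then show ?thesis using True by simp
  next
    case False
    have "p + 2 * (- q / r) * q + (- q / r)\<^sup>2 * r = p - q\<^sup>2 / r"
      using False by (simp add: power2_eq_square field_simps)
    with *[of "- q / r"] have "q\<^sup>2 / r \<le> p" by simp
    then show ?thesis using \<open>r \<ge> 0\<close> False by (simp add: field_simps)
  qed
  then show ?thesis by (simp add: p_def q_def r_def)
qed

lemma resolvent_symmetric:
  assumes "self_adjoint D A" "\<And>y. S y \<in> D" "\<And>y. A (S y) - \<mu> *\<^sub>R S y = y"
  shows "inner (S x) y = inner x (S y)"
proof -
  have "inner (S x) (A (S y) - \<mu> *\<^sub>R S y) = inner (A (S x) - \<mu> *\<^sub>R S x) (S y)"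
    using self_adjoint_symmetric[OF assms(1), of "S x" "S y"] assms(2)
    by (simp add: inner_diff_left inner_diff_right)
  then show ?thesis by (simp only: assms(3))
qed

text \<open>For a symmetric bounded operator with norm \<open>m\<close>, the operator \<open>m\<^sup>2 - S\<^sup>2\<close> is positive but not
  bounded below; applied to \<open>S = (A - \<mu>)\<inverse>\<close> this produces spectrum at distance \<open>1 / m\<close> from \<open>\<mu>\<close>.\<close>

lemma spectral_gap_lower_bound:
  assumes sa: "self_adjoint D A" and d: "d > 0"
    and gap: "{\<mu> - d<..<\<mu> + d} \<subseteq> resolvent_set D A" and x: "x \<in> D"
  shows "d * norm x \<le> norm (A x - \<mu> *\<^sub>R x)"
proof -
  have "\<mu> \<in> resolvent_set D A" using gap d by auto
  then obtain S where S: "bounded_linear S" "\<And>y. S y \<in> D" "\<And>y. A (S y) - \<mu> *\<^sub>R S y = y"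
    "\<And>x. x \<in> D \<Longrightarrow> S (A x - \<mu> *\<^sub>R x) = x"
    using resolvent_setE by metis
  have sym: "inner (S x) y = inner x (S y)" for x y
    by (rule resolvent_symmetric[OF sa S(2,3)])
  interpret S: bounded_linear S by (rule S(1))
  define m where "m = onorm S"
  have m: "norm (S y) \<le> m * norm y" for y unfolding m_def by (rule onorm[OF S(1)])
  have "m \<le> 1 / d"
  proof (rule ccontr)
    assume "\<not> m \<le> 1 / d"
    then have "1 / d < m" by simp
    moreover have "0 < 1 / d" using d by simp
    ultimately have m0: "m > 0" by linarith
    with \<open>1 / d < m\<close> have md: "1 / m < d" using d by (simp add: field_simps)
    \<comment> \<open>Since \<open>1 / m < d\<close>, both \<open>\<mu> + 1 / m\<close> and
      \<open>\<mu> - 1 / m\<close> lie in the gap. The identity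
      \<open>m - s S = m (A - \<mu> - s / m) S\<close> carries the lower bound there over to
      \<open>m - s S\<close>.\<close>
    have below: "\<exists>e>0. \<forall>y. e * norm y \<le> norm (m *\<^sub>R y - s *\<^sub>R S y)" if s: "\<bar>s\<bar> = 1" for s
    proof -
      have "\<mu> + s / m \<in> resolvent_set D A"
        using gap md m0 s by (intro subsetD[OF gap]) (auto simp: abs_if field_simps split: if_splits)
      then obtain c where c: "c > 0" "\<And>u. u \<in> D \<Longrightarrow> c * norm u \<le> norm (A u - (\<mu> + s / m) *\<^sub>R u)"
        using resolvent_lower_bound by blast
      \<comment> \<open>Collects \<open>norm y \<le> norm w + norm (S y) / m\<close> and
        \<open>norm (S y) \<le> norm w / c\<close>, where
        \<open>w = (A - \<mu> - s / m) (S y)\<close>.\<close>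
      define k where "k = 1 + 1 / (m * c)"
      have k: "k > 0" using c(1) m0 by (simp add: k_def add_pos_pos)
      have "m / k * norm y \<le> norm (m *\<^sub>R y - s *\<^sub>R S y)" for y
      proof -
        let ?w = "A (S y) - (\<mu> + s / m) *\<^sub>R S y"
        have y: "y = ?w + (s / m) *\<^sub>R S y" using S(3)[of y] by (simp add: algebra_simps)
        have "norm y \<le> norm ?w + norm ((s / m) *\<^sub>R S y)"
          by (subst y) (rule norm_triangle_ineq)
        also have "norm ((s / m) *\<^sub>R S y) = norm (S y) / m" using s m0 by simp
        also have "norm (S y) / m \<le> norm ?w / (m * c)"
          using c(2)[OF S(2)[of y]] c(1) m0 by (simp add: field_simps)
        finally have "norm y \<le> k * norm ?w" by (simp add: k_def algebra_simps)
        moreover have "m *\<^sub>R y - s *\<^sub>R S y = m *\<^sub>R ?w"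
          using m0 by (subst y) (simp add: algebra_simps)
        ultimately show ?thesis using m0 k
          by (simp only: norm_scaleR) (simp add: pos_divide_le_eq mult.assoc mult.commute[of k] mult_left_mono)
      qed
      then show ?thesis using m0 k by (intro exI[of _ "m / k"]) auto
    qed
    obtain e1 where e1: "e1 > 0" "\<And>y. e1 * norm y \<le> norm (m *\<^sub>R y - S y)" using below[of 1] by auto
    obtain e2 where e2: "e2 > 0" "\<And>y. e2 * norm y \<le> norm (m *\<^sub>R y + S y)" using below[of "-1"] by auto
    \<comment> \<open>\<open>C = (m - S) (m + S)\<close> is bounded below because both factors
      are.\<close>
    define C where "C y = m\<^sup>2 *\<^sub>R y - S (S y)" for y
    have C_lin: "linear C"
      unfolding C_def by (intro linearI) (simp_all add: S.add S.scaleR algebra_simps)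
    have C_sym: "inner (C u) v = inner u (C v)" for u v
      by (simp add: C_def inner_diff_left inner_diff_right sym)
    have C_form: "inner (C u) u = m\<^sup>2 * (norm u)\<^sup>2 - (norm (S u))\<^sup>2" for u
      by (simp add: C_def inner_diff_left sym power2_norm_eq_inner)
    have C_pos: "inner (C u) u \<ge> 0" for u
      using m[of u] power_mono[OF m[of u], of 2] by (simp add: C_form power_mult_distrib)
    have C_below: "e1 * e2 * norm u \<le> norm (C u)" for u
    proof -
      have "C u = m *\<^sub>R (m *\<^sub>R u + S u) - S (m *\<^sub>R u + S u)"
        by (simp add: C_def S.add S.scaleR power2_eq_square algebra_simps)
      then have "e1 * norm (m *\<^sub>R u + S u) \<le> norm (C u)" using e1(2) by metis
      moreover have "e1 * (e2 * norm u) \<le> e1 * norm (m *\<^sub>R u + S u)"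
        using e1(1) e2(2) by (intro mult_left_mono) auto
      ultimately show ?thesis by (simp add: mult.assoc)
    qed
    \<comment> \<open>Cauchy-Schwarz for the form of \<open>C\<close>, with \<open>C u\<close> as
      second argument, combined with \<open>C \<le> m\<^sup>2\<close>.\<close>
    have C_upper: "(norm (C u))\<^sup>2 \<le> m\<^sup>2 * inner (C u) u" for u
    proof (cases "C u = 0")
      case False
      have "(inner (C u) (C u))\<^sup>2 \<le> inner (C u) u * inner (C (C u)) (C u)"
        by (rule Cauchy_Schwarz_semidefinite[OF C_lin C_sym C_pos])
      also have "\<dots> \<le> inner (C u) u * (m\<^sup>2 * (norm (C u))\<^sup>2)"
        using C_pos by (intro mult_left_mono) (simp_all add: C_form)
      finally have "(norm (C u))\<^sup>2 * (norm (C u))\<^sup>2 \<le> (m\<^sup>2 * inner (C u) u) * (norm (C u))\<^sup>2"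
        unfolding power2_norm_eq_inner by (simp add: power2_eq_square ac_simps)
      then show ?thesis by (rule mult_right_le_imp_le) (use False in simp)
    qed (use C_pos in simp)
    \<comment> \<open>The two bounds on \<open>C\<close> give \<open>C \<ge> e\<close>, that is
      \<open>S\<^sup>2 \<le> m\<^sup>2 - e\<close>, which contradicts that \<open>m\<close> is the
      operator norm of \<open>S\<close>. The \<open>max 0\<close> below keeps the radicand
      nonnegative.\<close>
    define e where "e = (e1 * e2)\<^sup>2 / m\<^sup>2"
    have e: "e > 0" using e1 e2 m0 by (simp add: e_def)
    have "(norm (S u))\<^sup>2 \<le> (m\<^sup>2 - e) * (norm u)\<^sup>2" for u
    proof -
      have "(e1 * e2 * norm u)\<^sup>2 \<le> (norm (C u))\<^sup>2"
        using C_below e1(1) e2(1) by (intro power_mono) auto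
      also have "\<dots> \<le> m\<^sup>2 * inner (C u) u" by (rule C_upper)
      finally have "e * (norm u)\<^sup>2 \<le> inner (C u) u"
        using m0 by (simp add: e_def power_mult_distrib field_simps)
      then show ?thesis by (simp add: C_form algebra_simps)
    qed
    then have "(norm (S u))\<^sup>2 \<le> (max 0 (m\<^sup>2 - e)) * (norm u)\<^sup>2" for u
      by (meson max.cobounded2 mult_right_mono order_trans zero_le_power2)
    then have bound: "norm (S u) \<le> sqrt (max 0 (m\<^sup>2 - e)) * norm u" for u
      using real_le_rsqrt[of "norm (S u)" "max 0 (m\<^sup>2 - e) * (norm u)\<^sup>2"] by (simp add: real_sqrt_mult)
    have "m \<le> sqrt (max 0 (m\<^sup>2 - e))" unfolding m_def by (rule onorm_bound) (use bound in \<open>simp_all add: m_def\<close>)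
    moreover have "sqrt (max 0 (m\<^sup>2 - e)) < m"
      using m0 e by (intro real_less_lsqrt) auto
    ultimately show False by simp
  qed
  then have "norm (S y) \<le> norm y / d" for y
    using m[of y] mult_right_mono[of m "1 / d" "norm y"] by simp
  from this[of "A x - \<mu> *\<^sub>R x"] show ?thesis using S(4)[OF x] d by (simp add: field_simps)
qed

text \<open>For the midpoint \<mu> and half-length \<open>d\<close> of the gap, \<open>(A -
  \<alpha>) (A - \<gamma>) = (A - \<mu>)\<^sup>2 - d\<^sup>2\<close>, and \<open>A - \<mu>\<close>
  is bounded below by \<open>d\<close>.\<close>

lemma spectral_gap_form_nonneg:
  assumes sa: "self_adjoint D A" and "\<alpha> < \<gamma>"
    and gap: "{\<alpha><..<\<gamma>} \<subseteq> resolvent_set D A" and x: "x \<in> D"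
  shows "inner (A x - \<alpha> *\<^sub>R x) (A x - \<gamma> *\<^sub>R x) \<ge> 0"
proof -
  define \<mu> d where "\<mu> = (\<alpha> + \<gamma>) / 2" and "d = (\<gamma> - \<alpha>) / 2"
  have eq: "\<alpha> = \<mu> - d" "\<gamma> = \<mu> + d" by (auto simp: \<mu>_def d_def field_simps)
  have d: "d > 0" using assms by (simp add: d_def)
  have "d * norm x \<le> norm (A x - \<mu> *\<^sub>R x)"
    by (rule spectral_gap_lower_bound[OF sa d _ x]) (use gap eq in simp)
  then have "(d * norm x)\<^sup>2 \<le> (norm (A x - \<mu> *\<^sub>R x))\<^sup>2" using d by (intro power_mono) auto
  then have "d\<^sup>2 * inner x x \<le> inner (A x - \<mu> *\<^sub>R x) (A x - \<mu> *\<^sub>R x)"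
    by (simp add: power_mult_distrib power2_norm_eq_inner)
  moreover have "inner (A x - \<alpha> *\<^sub>R x) (A x - \<gamma> *\<^sub>R x) =
      inner (A x - \<mu> *\<^sub>R x) (A x - \<mu> *\<^sub>R x) - d\<^sup>2 * inner x x"
    unfolding eq by (simp add: inner_diff_left inner_diff_right inner_add_left inner_add_right
        inner_commute power2_eq_square algebra_simps)
  ultimately show ?thesis by simp
qed

lemma subspace_closure:
  fixes S :: "'a::real_normed_vector set"
  assumes "subspace S"
  shows "subspace (closure S)"
  unfolding subspace_def
proof (intro conjI ballI allI)
  show "0 \<in> closure S" using subspace_0[OF assms] closure_subset by blast
  show "x + y \<in> closure S" if "x \<in> closure S" "y \<in> closure S" for x y
  proof -
    obtain u where "\<forall>n. u n \<in> S" "u \<longlonglongrightarrow> x" using \<open>x \<in> closure S\<close> unfolding closure_sequential by blast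
    moreover obtain v where "\<forall>n. v n \<in> S" "v \<longlonglongrightarrow> y" using \<open>y \<in> closure S\<close> unfolding closure_sequential by blast
    ultimately show ?thesis unfolding closure_sequential
      by (intro exI[of _ "\<lambda>n. u n + v n"]) (auto intro: tendsto_add subspace_add[OF assms])
  qed
  show "c *\<^sub>R x \<in> closure S" if "x \<in> closure S" for c x
  proof -
    obtain u where "\<forall>n. u n \<in> S" "u \<longlonglongrightarrow> x" using \<open>x \<in> closure S\<close> unfolding closure_sequential by blast
    then show ?thesis unfolding closure_sequential
      by (intro exI[of _ "\<lambda>n. c *\<^sub>R u n"]) (auto intro: tendsto_scaleR subspace_scale[OF assms])
  qed
qed

text \<open>\<open>R\<^sup>2 \<ge> c R\<close> leaves room for spectrum only at 0 and from
  \<open>c\<close> upwards; injectivity removes 0. Concretely, the bound holds on the range of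
  \<open>R\<close> by Cauchy-Schwarz and on its closure by continuity, and injectivity makes the
  range dense.\<close>

lemma injective_semidefinite_coercive:
  fixes R :: "'a::{real_inner, complete_space} \<Rightarrow> 'a"
  assumes R: "bounded_linear R" and sym: "\<And>x y. inner (R x) y = inner x (R y)"
    and pos: "\<And>x. inner (R x) x \<ge> 0" and c: "c > 0"
    and sq: "\<And>x. c * inner (R x) x \<le> (norm (R x))\<^sup>2"
    and inj: "\<And>x. R x = 0 \<Longrightarrow> x = 0"
  shows "c * (norm z)\<^sup>2 \<le> inner (R z) z"
proof -
  interpret R: bounded_linear R by (rule R)
  define G where "G = {z. c * (norm z)\<^sup>2 \<le> inner (R z) z}"
  have "closed G"
    unfolding G_def by (intro closed_Collect_le continuous_intros R.continuous_on)
  have "range R \<subseteq> G"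
  proof clarify
    fix y
    let ?z = "R y"
    have "(inner (R y) ?z)\<^sup>2 \<le> inner (R y) y * inner (R ?z) ?z"
      by (rule Cauchy_Schwarz_semidefinite[OF R.linear sym pos])
    then have "c * (inner (R y) ?z)\<^sup>2 \<le> c * inner (R y) y * inner (R ?z) ?z"
      using c by (simp add: mult.assoc)
    also have "\<dots> \<le> (norm ?z)\<^sup>2 * inner (R ?z) ?z"
      using sq pos by (intro mult_right_mono) auto
    finally have "(norm ?z)\<^sup>2 * (c * (norm ?z)\<^sup>2) \<le> (norm ?z)\<^sup>2 * inner (R ?z) ?z"
      unfolding power2_norm_eq_inner by (simp add: power2_eq_square ac_simps)
    then show "?z \<in> G" by (cases "?z = 0") (auto simp: G_def R.zero mult_le_cancel_left)
  qed
  define Y where "Y = closure (range R)"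
  have YG: "Y \<subseteq> G" unfolding Y_def by (rule closure_minimal[OF \<open>range R \<subseteq> G\<close> \<open>closed G\<close>])
  have "subspace (range R)" by (rule linear_subspace_image[OF R.linear subspace_UNIV])
  then have subY: "subspace Y" unfolding Y_def by (rule subspace_closure)
  obtain k where k: "k > 0" "\<And>x. norm (R x) \<le> norm x * k" using R.pos_bounded by blast
  define m where "m = max k c"
  have m: "m > 0" "m \<ge> c" using k c by (auto simp: m_def)
  have m_bound: "norm (R x) \<le> m * norm x" for x
  proof -
    have "k * norm x \<le> m * norm x" by (intro mult_right_mono) (auto simp: m_def)
    then show ?thesis using k(2)[of x] by (simp add: mult.commute)
  qed
  \<comment> \<open>\<open>t\<close> minimises \<open>1 - 2 * t * c + t\<^sup>2 * m\<^sup>2\<close>,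
    the bound for the squared contraction factor; the minimum is
    \<open>1 - c\<^sup>2 / m\<^sup>2\<close>, nonnegative since \<open>m \<ge> c\<close>.\<close>
  define t q where "t = c / m\<^sup>2" and "q = sqrt (1 - c\<^sup>2 / m\<^sup>2)"
  have c2m2: "c\<^sup>2 / m\<^sup>2 \<le> 1" "c\<^sup>2 / m\<^sup>2 > 0" using c m by (auto simp: power_mono)
  have contr: "norm (u - t *\<^sub>R R u) \<le> q * norm u" if "u \<in> Y" for u
  proof -
    have "(norm (u - t *\<^sub>R R u))\<^sup>2 = (norm u)\<^sup>2 - 2 * t * inner (R u) u + t\<^sup>2 * (norm (R u))\<^sup>2"
      unfolding power2_norm_eq_inner using inner_commute[of u "R u"]
      by (simp add: inner_diff_left inner_diff_right power2_eq_square algebra_simps)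
    also have "\<dots> \<le> (norm u)\<^sup>2 - 2 * t * (c * (norm u)\<^sup>2) + t\<^sup>2 * (m * norm u)\<^sup>2"
    proof -
      have "2 * t * (c * (norm u)\<^sup>2) \<le> 2 * t * inner (R u) u"
        using that YG c m by (intro mult_left_mono) (auto simp: G_def t_def)
      moreover have "t\<^sup>2 * (norm (R u))\<^sup>2 \<le> t\<^sup>2 * (m * norm u)\<^sup>2"
        using m_bound by (intro mult_left_mono power_mono) auto
      ultimately show ?thesis by linarith
    qed
    also have "\<dots> = (1 - c\<^sup>2 / m\<^sup>2) * (norm u)\<^sup>2"
      using m by (simp add: t_def power2_eq_square field_simps)
    finally have "norm (u - t *\<^sub>R R u) \<le> sqrt ((1 - c\<^sup>2 / m\<^sup>2) * (norm u)\<^sup>2)" by (rule real_le_rsqrt)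
    then show ?thesis by (simp add: q_def real_sqrt_mult)
  qed
  \<comment> \<open>Density without orthogonal complements: the damped iteration for
    \<open>R x = R z\<close> stays in \<open>Y\<close>, and its fixed point can only be
    \<open>z\<close>, so \<open>z \<in> Y\<close>.\<close>
  have "\<exists>!x. x \<in> Y \<and> x - t *\<^sub>R R (x - z) = x"
  proof (rule Banach_fix[of Y q])
    show "complete Y" unfolding Y_def by (simp add: complete_eq_closed)
    show "Y \<noteq> {}" unfolding Y_def by auto
    show "0 \<le> q" "q < 1" using c2m2 by (auto simp: q_def)
    show "(\<lambda>x. x - t *\<^sub>R R (x - z)) ` Y \<subseteq> Y"
    proof clarify
      fix x assume "x \<in> Y"
      moreover have "R (x - z) \<in> Y" unfolding Y_def by (rule subsetD[OF closure_subset rangeI])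
      ultimately show "x - t *\<^sub>R R (x - z) \<in> Y" by (intro subspace_diff[OF subY] subspace_scale[OF subY])
    qed
    show "dist (x - t *\<^sub>R R (x - z)) (y - t *\<^sub>R R (y - z)) \<le> q * dist x y" if "x \<in> Y" "y \<in> Y" for x y
      using contr[OF subspace_diff[OF subY that]] by (simp add: dist_norm R.diff algebra_simps)
  qed
  then obtain x where "x \<in> Y" "t *\<^sub>R R (x - z) = 0" by auto
  then have "z \<in> Y" using inj[of "x - z"] c m by (simp add: t_def)
  then show ?thesis using YG by (auto simp: G_def)
qed

text \<open>The operator \<open>R = (A - \<kappa>) (A - \<kappa> - \<delta>)\<inverse>\<close> is positive with \<open>R\<^sup>2 \<ge> R / 2\<close> because of the gaps
  on the two sides of \<open>\<kappa>\<close>.\<close>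

lemma isolated_non_eigenvalue_in_resolvent_set:
  fixes A :: "'a::{real_inner, complete_space} \<Rightarrow> 'a"
  assumes sa: "self_adjoint D A" and d: "d > 0"
    and gap: "\<And>\<nu>. \<nu> \<noteq> \<kappa> \<Longrightarrow> \<bar>\<nu> - \<kappa>\<bar> < d \<Longrightarrow> \<nu> \<in> resolvent_set D A"
    and inj: "\<And>x. x \<in> D \<Longrightarrow> A x = \<kappa> *\<^sub>R x \<Longrightarrow> x = 0"
  shows "\<kappa> \<in> resolvent_set D A"
proof -
  note lin = self_adjoint_linear[OF sa]
  \<comment> \<open>Half of \<open>d\<close> keeps \<open>\<kappa> + \<delta>\<close> and both open
    intervals of length \<delta> next to \<kappa> inside the punctured gap.\<close>
  define \<delta> where "\<delta> = d / 2"
  have \<delta>: "\<delta> > 0" "\<delta> < d" using d by (auto simp: \<delta>_def)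
  have "\<kappa> + \<delta> \<in> resolvent_set D A" using \<delta> by (intro gap) auto
  then obtain S where S: "bounded_linear S" "\<And>y. S y \<in> D" "\<And>y. A (S y) - (\<kappa> + \<delta>) *\<^sub>R S y = y"
    "\<And>x. x \<in> D \<Longrightarrow> S (A x - (\<kappa> + \<delta>) *\<^sub>R x) = x"
    using resolvent_setE by metis
  define R where "R y = y + \<delta> *\<^sub>R S y" for y
  have R_eq: "R y = A (S y) - \<kappa> *\<^sub>R S y" for y
  proof -
    have "R y = (A (S y) - (\<kappa> + \<delta>) *\<^sub>R S y) + \<delta> *\<^sub>R S y" by (simp only: R_def S(3))
    then show ?thesis by (simp add: algebra_simps)
  qed
  have coercive: "1/2 * (norm y)\<^sup>2 \<le> inner (R y) y" for y
  proof (rule injective_semidefinite_coercive)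
    show "bounded_linear R" unfolding R_def
      by (intro bounded_linear_add bounded_linear_ident bounded_linear_compose[OF bounded_linear_scaleR_right S(1)])
    show "inner (R x) y = inner x (R y)" for x y
      using resolvent_symmetric[OF sa S(2,3)] by (simp add: R_def inner_add_left inner_add_right)
    show "0 \<le> inner (R x) x" for x
    proof -
      have "inner (A (S x) - \<kappa> *\<^sub>R S x) (A (S x) - (\<kappa> + \<delta>) *\<^sub>R S x) \<ge> 0"
        using \<delta> by (intro spectral_gap_form_nonneg[OF sa _ _ S(2)] subsetI gap) auto
      then show ?thesis by (simp only: S(3) R_eq)
    qed
    \<comment> \<open>The gap above \<kappa> gave positivity; the gap below gives this bound,
      because \<open>(A - \<kappa> + \<delta>) (S x) = R x + \<delta> S x = 2 R x -
      x\<close>.\<close>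
    show "1 / 2 * inner (R x) x \<le> (norm (R x))\<^sup>2" for x
    proof -
      let ?u = "S x"
      have "inner (A ?u - (\<kappa> - \<delta>) *\<^sub>R ?u) (A ?u - \<kappa> *\<^sub>R ?u) \<ge> 0"
        using \<delta> by (intro spectral_gap_form_nonneg[OF sa _ _ S(2)] subsetI gap) auto
      moreover have "A ?u - (\<kappa> - \<delta>) *\<^sub>R ?u = 2 *\<^sub>R R x - x"
        using S(3)[of x] by (simp add: R_eq algebra_simps flip: scaleR_2)
      ultimately have "inner (2 *\<^sub>R R x - x) (R x) \<ge> 0" by (simp add: R_eq)
      then show ?thesis by (simp add: inner_diff_left power2_norm_eq_inner inner_commute[of x])
    qed
    show "x = 0" if "R x = 0" for x
    proof -
      have "S x = 0" using inj[OF S(2)] that by (simp add: R_eq)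
      then show ?thesis using that by (simp add: R_def)
    qed
  qed simp
  \<comment> \<open>The factor 3 comes from
    \<open>\<delta> * norm u \<le> norm (R y) + norm y\<close> and
    \<open>norm y \<le> 2 * norm (R y)\<close>, where \<open>R y = A u - \<kappa> u\<close>.\<close>
  define e where "e = \<delta> / 3"
  have e: "e > 0" using \<delta> by (simp add: e_def)
  have lower: "e * norm u \<le> norm (A u - \<kappa> *\<^sub>R u)" if u: "u \<in> D" for u
  proof -
    let ?y = "A u - (\<kappa> + \<delta>) *\<^sub>R u"
    have Ry: "R ?y = A u - \<kappa> *\<^sub>R u" using R_eq[of ?y] S(4)[OF u] by simp
    have "1/2 * (norm ?y)\<^sup>2 \<le> norm (R ?y) * norm ?y"
      using coercive[of ?y] norm_cauchy_schwarz[of "R ?y" ?y] by linarith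
    then have "norm ?y \<le> 2 * norm (R ?y)"
      by (cases "?y = 0") (auto simp: power2_eq_square)
    moreover have "norm (\<delta> *\<^sub>R u) \<le> norm (A u - \<kappa> *\<^sub>R u) + norm ?y"
      using norm_triangle_ineq4[of "A u - \<kappa> *\<^sub>R u" ?y] by (simp add: algebra_simps)
    ultimately show ?thesis using \<delta> by (simp add: Ry e_def)
  qed
  \<comment> \<open>A point at distance \<epsilon> from \<kappa> keeps the lower bound
    \<open>e - \<epsilon>\<close>; this exceeds \<epsilon>, so the perturbation radius reaches back
    to \<kappa>.\<close>
  define \<epsilon> where "\<epsilon> = min (e / 3) \<delta>"
  have \<epsilon>: "\<epsilon> > 0" "\<epsilon> < d" "\<epsilon> < e - \<epsilon>" using e \<delta> by (auto simp: \<epsilon>_def)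
  show ?thesis
  proof (rule resolvent_set_perturb[OF lin, where \<mu> = "\<kappa> + \<epsilon>" and d = "e - \<epsilon>"])
    show "\<kappa> + \<epsilon> \<in> resolvent_set D A" using \<epsilon> by (intro gap) auto
    show "(e - \<epsilon>) * norm x \<le> norm (A x - (\<kappa> + \<epsilon>) *\<^sub>R x)" if "x \<in> D" for x
    proof -
      have "norm (A x - \<kappa> *\<^sub>R x) \<le> norm (A x - (\<kappa> + \<epsilon>) *\<^sub>R x) + norm (\<epsilon> *\<^sub>R x)"
        using norm_triangle_ineq[of "A x - (\<kappa> + \<epsilon>) *\<^sub>R x" "\<epsilon> *\<^sub>R x"] by (simp add: algebra_simps)
      then show ?thesis using lower[OF that] \<epsilon> by (simp add: algebra_simps)
    qed
  qed (use \<epsilon> in simp)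
qed


section \<open>Clearing an interval of spectrum by a finite rank operator\<close>

lemma self_adjoint_add_bounded:
  assumes sa: "self_adjoint D A" and K: "linear K" "\<And>x y. inner (K x) y = inner x (K y)"
  shows "self_adjoint D (\<lambda>x. A x + K x)"
proof -
  have "adjoint_graph D (\<lambda>x. A x + K x) = {(y, A y + K y) |y. y \<in> D}"
  proof -
    \<comment> \<open>A symmetric operator defined everywhere moves to the other side of the inner
      product and only translates the adjoint graph.\<close>
    have "(y, w) \<in> adjoint_graph D (\<lambda>x. A x + K x) \<longleftrightarrow> (y, w - K y) \<in> adjoint_graph D A" for y w
      by (auto simp: adjoint_graph_def inner_add_left inner_diff_right K(2) algebra_simps)
    also have "\<dots> y w \<longleftrightarrow> y \<in> D \<and> w = A y + K y" for y w
      using sa by (auto simp: self_adjoint_def algebra_simps)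
    finally show ?thesis by auto
  qed
  then show ?thesis
    using sa K(1) by (auto simp: self_adjoint_def linear_operator_def linear_add linear_scale algebra_simps)
qed

lemma subspace_eigenspace:
  assumes "linear_operator D A"
  shows "subspace (eigenspace D A \<mu>)"
proof -
  have "0 \<in> D" by (intro subspace_0 linear_operator_subspace[OF assms])
  then have "A 0 = 0" using linear_operator_diff[OF assms, of 0 0] by simp
  then show ?thesis
    using assms by (auto simp: eigenspace_def linear_operator_def subspace_def algebra_simps)
qed

text \<open>Adding \<open>c P\<close>, where \<open>P\<close> projects onto the eigenspace of \<open>\<kappa>\<close>, moves the spectral point
  \<open>\<kappa>\<close> to \<open>\<kappa> + c\<close>, outside of the interval for \<open>c = 2 b\<close>.\<close>

lemma shift_isolated_eigenvalue:
  fixes A :: "'a::{real_inner, complete_space} \<Rightarrow> 'a"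
  assumes sa: "self_adjoint D A" and \<kappa>: "\<bar>\<kappa>\<bar> < b" "\<kappa> isolated_in spectrum D A"
    and B: "finite B" "orthonormal B" "span B = eigenspace D A \<kappa>"
    and A': "A' = (\<lambda>x. A x + (2 * b) *\<^sub>R proj B x)"
  shows "self_adjoint D A'"
    and "spectrum D A' \<inter> {-b<..<b} \<subseteq> spectrum D A \<inter> {-b<..<b} - {\<kappa>}"
    and "\<And>\<mu>. \<bar>\<mu>\<bar> < b \<Longrightarrow> eigenspace D A' \<mu> \<subseteq> eigenspace D A \<mu>"
proof -
  note lin = self_adjoint_linear[OF sa]
  interpret P: bounded_linear "proj B" by (rule bounded_linear_proj)
  have E: "proj B y \<in> D" "A (proj B y) = \<kappa> *\<^sub>R proj B y" for y
    using proj_in_span[of B y] B(3) by (auto simp: eigenspace_def)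
  have PP: "proj B (proj B y) = proj B y" for y by (rule proj_id[OF B(1,2) proj_in_span])
  show sa': "self_adjoint D A'" unfolding A'
  proof (rule self_adjoint_add_bounded[OF sa])
    show "linear (\<lambda>x. (2 * b) *\<^sub>R proj B x)" by (intro linearI) (simp_all add: P.add P.scaleR algebra_simps)
  qed (simp add: proj_symmetric)
  note lin' = self_adjoint_linear[OF sa']
  \<comment> \<open>On the old eigenspace \<open>A'\<close> is multiplication by
    \<open>\<kappa> + 2 * b\<close>, which exceeds \<open>b\<close> since
    \<open>\<kappa> > -b\<close>. Eigenvectors of \<open>A'\<close> for \<mu> inside the interval
    are therefore orthogonal to that eigenspace.\<close>
  have orth: "proj B x = 0" if x: "x \<in> D" "A' x = \<mu> *\<^sub>R x" "\<bar>\<mu>\<bar> < b" for x \<mu>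
  proof -
    let ?p = "proj B x"
    have "inner (A' x) ?p = inner x (A' ?p)" by (rule self_adjoint_symmetric[OF sa' x(1) E(1)])
    moreover have "A' ?p = (\<kappa> + 2 * b) *\<^sub>R ?p" by (simp add: A' E PP scaleR_left_distrib)
    ultimately have "\<mu> * inner x ?p = (\<kappa> + 2 * b) * inner x ?p" by (simp add: x(2))
    then have "inner x ?p = 0" using \<kappa> x(3) by auto
    moreover have "inner x ?p = inner ?p ?p" using proj_symmetric[of B x ?p] PP by simp
    ultimately show ?thesis by simp
  qed
  show eig: "eigenspace D A' \<mu> \<subseteq> eigenspace D A \<mu>" if "\<bar>\<mu>\<bar> < b" for \<mu>
  proof
    fix x assume "x \<in> eigenspace D A' \<mu>"
    then have x: "x \<in> D" "A' x = \<mu> *\<^sub>R x" by (auto simp: eigenspace_def)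
    then show "x \<in> eigenspace D A \<mu>" using orth[OF x that] by (simp add: eigenspace_def A')
  qed
  have res: "\<nu> \<in> resolvent_set D A'" if \<nu>: "\<nu> \<in> resolvent_set D A" "\<bar>\<nu>\<bar> < b" for \<nu>
  proof -
    obtain S where S: "bounded_linear S" "\<And>y. S y \<in> D" "\<And>y. A (S y) - \<nu> *\<^sub>R S y = y"
      "\<And>x. x \<in> D \<Longrightarrow> S (A x - \<nu> *\<^sub>R x) = x"
      using resolvent_setE[OF \<nu>(1)] by metis
    interpret S: bounded_linear S by (rule S(1))
    have "\<nu> \<noteq> \<kappa>" using \<kappa>(2) \<nu>(1) by (auto simp: isolated_in_def spectrum_def)
    \<comment> \<open>The resolvent of \<open>A\<close> preserves the orthogonal complement of the
      eigenspace.\<close>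
    have SP: "proj B (S (y - proj B y)) = 0" for y
    proof -
      let ?w = "S (y - proj B y)"
      let ?p = "proj B ?w"
      have "inner (A ?w - \<nu> *\<^sub>R ?w) ?p = inner ?w (A ?p - \<nu> *\<^sub>R ?p)"
        using self_adjoint_symmetric[OF sa S(2) E(1)] by (simp add: inner_diff_left inner_diff_right)
      moreover have "inner (A ?w - \<nu> *\<^sub>R ?w) ?p = 0"
        unfolding S(3) by (rule inner_diff_proj[OF B(1,2) proj_in_span])
      ultimately have "(\<kappa> - \<nu>) * inner ?w ?p = 0" by (simp add: E inner_diff_right algebra_simps)
      then have "inner ?w ?p = 0" using \<open>\<nu> \<noteq> \<kappa>\<close> by simp
      moreover have "inner ?w ?p = inner ?p ?p" using proj_symmetric[of B ?w ?p] PP by simp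
      ultimately show ?thesis by simp
    qed
    define c where "c = \<kappa> + 2 * b - \<nu>"
    have c: "c \<noteq> 0" using \<nu>(2) \<kappa>(1) by (auto simp: c_def)
    \<comment> \<open>The inverse of \<open>A' - \<nu>\<close> splits: it is the old resolvent on
      the complement and division by \<open>\<kappa> + 2 * b - \<nu>\<close> on the
      eigenspace.\<close>
    define S' where "S' y = S (y - proj B y) + (1 / c) *\<^sub>R proj B y" for y
    have S'_D: "S' y \<in> D" for y
      unfolding S'_def using linear_operator_subspace[OF lin] S(2) E(1)
      by (intro subspace_add subspace_scale)
    have S'_bl: "bounded_linear S'" unfolding S'_def
      by (intro bounded_linear_add bounded_linear_compose[OF S(1)] bounded_linear_sub bounded_linear_ident
          bounded_linear_proj bounded_linear_compose[OF bounded_linear_scaleR_right bounded_linear_proj])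
    have S'_right: "A' (S' y) - \<nu> *\<^sub>R S' y = y" for y
    proof -
      have 1: "(1 / c) *\<^sub>R proj B y \<in> D" using subspace_scale[OF linear_operator_subspace[OF lin] E(1)] .
      have 2: "A ((1 / c) *\<^sub>R proj B y) = (1 / c) *\<^sub>R (\<kappa> *\<^sub>R proj B y)"
        using lin E by (simp add: linear_operator_def)
      have "A (S' y) = A (S (y - proj B y)) + (1 / c) *\<^sub>R (\<kappa> *\<^sub>R proj B y)"
        using lin S(2) 1 unfolding S'_def linear_operator_def by (simp add: 2)
      moreover have "proj B (S' y) = (1 / c) *\<^sub>R proj B y" by (simp add: S'_def P.add P.scaleR SP PP)
      ultimately have "A' (S' y) - \<nu> *\<^sub>R S' y = (A (S (y - proj B y)) - \<nu> *\<^sub>R S (y - proj B y)) +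
          (1 / c) *\<^sub>R ((\<kappa> + 2 * b - \<nu>) *\<^sub>R proj B y)"
        by (simp add: A' S'_def algebra_simps)
      also have "\<dots> = (y - proj B y) + proj B y" using c unfolding S(3) c_def[symmetric] by simp
      finally show ?thesis by simp
    qed
    have ker: "x = 0" if "x \<in> D" "A' x = \<nu> *\<^sub>R x" for x
    proof -
      have "x \<in> eigenspace D A \<nu>" using eig[OF \<nu>(2)] that by (auto simp: eigenspace_def)
      then show ?thesis using S(4)[of x] by (simp add: eigenspace_def S.zero)
    qed
    have S'_left: "S' (A' x - \<nu> *\<^sub>R x) = x" if "x \<in> D" for x
    proof -
      let ?u = "S' (A' x - \<nu> *\<^sub>R x)"
      have "?u - x \<in> D" using linear_operator_subspace[OF lin] S'_D that by (intro subspace_diff)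
      moreover have "A' (?u - x) = \<nu> *\<^sub>R (?u - x)"
        using S'_right[of "A' x - \<nu> *\<^sub>R x"]
        unfolding linear_operator_diff[OF lin' S'_D that] by (simp add: algebra_simps)
      ultimately show ?thesis using ker[of "?u - x"] by simp
    qed
    obtain k where k: "k > 0" "\<And>y. norm (S' y) \<le> norm y * k"
      using bounded_linear.pos_bounded[OF S'_bl] by blast
    show ?thesis
    proof (rule resolvent_setI[OF lin'])
      show "1 / k * norm x \<le> norm (A' x - \<nu> *\<^sub>R x)" if "x \<in> D" for x
        using k(2)[of "A' x - \<nu> *\<^sub>R x"] S'_left[OF that] k(1) by (simp add: field_simps)
      show "\<exists>x\<in>D. A' x - \<nu> *\<^sub>R x = y" for y using S'_D S'_right by blast
    qed (use k in simp)
  qed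
  \<comment> \<open>\<open>A\<close> has no resolvent at \<kappa> to modify. Instead, \<kappa> has a
    punctured neighbourhood in the resolvent set of \<open>A'\<close>, and an eigenvector of
    \<open>A'\<close> for it would lie in the old eigenspace and be orthogonal to it.\<close>
  have "\<kappa> \<in> resolvent_set D A'"
  proof -
    obtain e where e: "e > 0" "\<And>y. y \<in> spectrum D A \<Longrightarrow> dist \<kappa> y < e \<Longrightarrow> y = \<kappa>"
      using \<kappa>(2) unfolding isolated_in_dist_Ex_iff by blast
    show ?thesis
    proof (rule isolated_non_eigenvalue_in_resolvent_set[OF sa', of "min e (b - \<bar>\<kappa>\<bar>)"])
      show "\<nu> \<in> resolvent_set D A'" if "\<nu> \<noteq> \<kappa>" "\<bar>\<nu> - \<kappa>\<bar> < min e (b - \<bar>\<kappa>\<bar>)" for \<nu>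
      proof (rule res)
        show "\<nu> \<in> resolvent_set D A" using e(2)[of \<nu>] that by (auto simp: spectrum_def dist_real_def abs_minus_commute)
        show "\<bar>\<nu>\<bar> < b" using that by linarith
      qed
      show "x = 0" if "x \<in> D" "A' x = \<kappa> *\<^sub>R x" for x
      proof -
        have "x \<in> span B" using eig[OF \<kappa>(1)] that B(3) by (auto simp: eigenspace_def)
        then show ?thesis using proj_id[OF B(1,2)] orth[OF that \<kappa>(1)] by metis
      qed
    qed (use e \<kappa> in simp)
  qed
  then show "spectrum D A' \<inter> {-b<..<b} \<subseteq> spectrum D A \<inter> {-b<..<b} - {\<kappa>}"
    using res by (auto simp: spectrum_def abs_less_iff)
qed

text \<open>Infinitely many points would accumulate in the compact interval; the accumulation point
  can be neither an isolated spectral point nor in the resolvent set, which is open.\<close>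

lemma finite_spectrum_Icc:
  fixes A :: "'a::{real_inner, complete_space} \<Rightarrow> 'a"
  assumes lin: "linear_operator D A"
    and iso: "\<And>\<mu>. \<mu> \<in> spectrum D A \<inter> {-\<beta>..\<beta>} \<Longrightarrow> \<mu> isolated_in spectrum D A"
  shows "finite (spectrum D A \<inter> {-\<beta>..\<beta>})"
proof (rule ccontr)
  assume "infinite (spectrum D A \<inter> {-\<beta>..\<beta>})"
  then obtain \<mu> where \<mu>: "\<mu> \<in> {-\<beta>..\<beta>}" "\<mu> islimpt (spectrum D A \<inter> {-\<beta>..\<beta>})"
    using compact_Icc[of "-\<beta>" \<beta>] unfolding compact_eq_Bolzano_Weierstrass by (metis inf_le2)
  then have lim: "\<mu> islimpt spectrum D A" using islimpt_subset by blast
  have "\<mu> \<in> resolvent_set D A"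
    using iso[of \<mu>] \<mu>(1) lim by (auto simp: isolated_in_islimpt_iff spectrum_def)
  moreover obtain c where c: "c > 0" "\<And>x. x \<in> D \<Longrightarrow> c * norm x \<le> norm (A x - \<mu> *\<^sub>R x)"
    using resolvent_lower_bound[OF calculation] by blast
  ultimately have "\<nu> \<in> resolvent_set D A" if "\<bar>\<nu> - \<mu>\<bar> < c" for \<nu>
    using resolvent_set_perturb[OF lin _ c(2) that] by blast
  moreover obtain \<nu> where "\<nu> \<in> spectrum D A" "\<bar>\<nu> - \<mu>\<bar> < c"
    using lim c(1) unfolding islimpt_approachable dist_real_def by blast
  ultimately show False by (simp add: spectrum_def)
qed

text \<open>Each step removes one spectral point. The discreteness hypothesis is kept on the larger
  open interval up to \<open>b\<close>: there shifting creates no spectrum and only shrinks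
  eigenspaces, so the hypothesis survives, while the points counted lie in a compact
  subinterval.\<close>

lemma finite_rank_spectral_shift:
  fixes A :: "'a::{real_inner, complete_space} \<Rightarrow> 'a"
  assumes "self_adjoint D A" and "\<beta> < b"
    and "\<And>\<mu>. \<mu> \<in> spectrum D A \<Longrightarrow> \<bar>\<mu>\<bar> < b \<Longrightarrow>
      \<mu> isolated_in spectrum D A \<and> finite_dimensional (eigenspace D A \<mu>)"
  shows "\<exists>K. bounded_linear K \<and> finite_dimensional (range K) \<and>
    self_adjoint D (\<lambda>x. A x + K x) \<and> spectrum D (\<lambda>x. A x + K x) \<inter> {-\<beta>..\<beta>} = {}"
  using assms
proof (induction "card (spectrum D A \<inter> {-\<beta>..\<beta>})" arbitrary: A rule: less_induct)
  case less
  note sa = less.prems(1) and \<beta> = less.prems(2) and disc = less.prems(3)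
  note lin = self_adjoint_linear[OF sa]
  have fin: "finite (spectrum D A \<inter> {-\<beta>..\<beta>})"
    using disc \<beta> by (intro finite_spectrum_Icc[OF lin]) (auto simp: abs_less_iff)
  show ?case
  proof (cases "spectrum D A \<inter> {-\<beta>..\<beta>} = {}")
    case True
    have "finite_dimensional (range (\<lambda>x. 0 :: 'a))"
      unfolding finite_dimensional_def by (intro exI[of _ "{}"]) auto
    then show ?thesis using True sa by (intro exI[of _ "\<lambda>x. 0"]) simp
  next
    case False
    then obtain \<kappa> where \<kappa>: "\<kappa> \<in> spectrum D A" "-\<beta> \<le> \<kappa>" "\<kappa> \<le> \<beta>" by auto
    then have \<kappa>b: "\<bar>\<kappa>\<bar> < b" using \<beta> by auto
    obtain B where B: "finite B" "orthonormal B" "span B = eigenspace D A \<kappa>"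
      using finite_dimensional_orthonormal_basis[OF _ subspace_eigenspace[OF lin]] disc[OF \<kappa>(1) \<kappa>b] by metis
    define A' where "A' = (\<lambda>x. A x + (2 * b) *\<^sub>R proj B x)"
    have iso: "\<kappa> isolated_in spectrum D A" using disc[OF \<kappa>(1) \<kappa>b] by simp
    note A' = shift_isolated_eigenvalue[OF sa \<kappa>b iso B A'_def]
    have sub: "spectrum D A' \<inter> {-\<beta>..\<beta>} \<subseteq> spectrum D A \<inter> {-\<beta>..\<beta>} - {\<kappa>}"
    proof
      fix \<mu> assume "\<mu> \<in> spectrum D A' \<inter> {-\<beta>..\<beta>}"
      moreover then have "\<mu> \<in> spectrum D A' \<inter> {-b<..<b}" using \<beta> by auto
      ultimately show "\<mu> \<in> spectrum D A \<inter> {-\<beta>..\<beta>} - {\<kappa>}" using A'(2) by blast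
    qed
    have "spectrum D A' \<inter> {-\<beta>..\<beta>} \<subset> spectrum D A \<inter> {-\<beta>..\<beta>}" using sub \<kappa> by auto
    then have card: "card (spectrum D A' \<inter> {-\<beta>..\<beta>}) < card (spectrum D A \<inter> {-\<beta>..\<beta>})"
      using fin by (intro psubset_card_mono)
    have "\<exists>K. bounded_linear K \<and> finite_dimensional (range K) \<and>
      self_adjoint D (\<lambda>x. A' x + K x) \<and> spectrum D (\<lambda>x. A' x + K x) \<inter> {-\<beta>..\<beta>} = {}"
    proof (rule less.hyps[OF card A'(1) \<beta>])
      fix \<mu> assume \<mu>: "\<mu> \<in> spectrum D A'" "\<bar>\<mu>\<bar> < b"
      then have near: "\<mu> \<in> spectrum D A" using A'(2) by (auto simp: abs_less_iff)
      then obtain T where T: "open T" "T \<inter> spectrum D A = {\<mu>}"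
        using disc[OF near \<mu>(2)] by (auto simp: isolated_in_def)
      have "(T \<inter> {-b<..<b}) \<inter> spectrum D A' = {\<mu>}"
        using T(2) \<mu> A'(2) by (auto simp: abs_less_iff)
      moreover have "open (T \<inter> {-b<..<b})" using T(1) by (intro open_Int) auto
      ultimately have "\<mu> isolated_in spectrum D A'" using \<mu>(1) by (auto simp: isolated_in_def)
      moreover have "finite_dimensional (eigenspace D A' \<mu>)"
        using disc[OF near \<mu>(2)] A'(3)[OF \<mu>(2)] by (auto simp: finite_dimensional_def)
      ultimately show "\<mu> isolated_in spectrum D A' \<and> finite_dimensional (eigenspace D A' \<mu>)" ..
    qed
    then obtain K where K: "bounded_linear K" "finite_dimensional (range K)"
      "self_adjoint D (\<lambda>x. A' x + K x)" "spectrum D (\<lambda>x. A' x + K x) \<inter> {-\<beta>..\<beta>} = {}" by blast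
    obtain T where T: "finite T" "range K \<subseteq> span T" using K(2) by (auto simp: finite_dimensional_def)
    let ?K = "\<lambda>x. (2 * b) *\<^sub>R proj B x + K x"
    have "range ?K \<subseteq> span (B \<union> T)"
    proof clarify
      fix x
      have "proj B x \<in> span (B \<union> T)" "K x \<in> span (B \<union> T)"
        using proj_in_span[of B x] T(2) span_mono[of B "B \<union> T"] span_mono[of T "B \<union> T"] by auto
      then show "?K x \<in> span (B \<union> T)" by (intro span_add span_scale)
    qed
    then have "finite_dimensional (range ?K)" using B(1) T(1) unfolding finite_dimensional_def by blast
    moreover have "bounded_linear ?K"
      by (intro bounded_linear_add K(1) bounded_linear_compose[OF bounded_linear_scaleR_right bounded_linear_proj])
    moreover have "(\<lambda>x. A x + ?K x) = (\<lambda>x. A' x + K x)" by (simp add: A'_def add.assoc)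
    ultimately show ?thesis using K(3,4) by (intro exI[of _ ?K]) simp
  qed
qed

text \<open>Bare invertibility of \<open>A + K\<close> would not do: the bound
  \<open>1 / \<beta>\<close>, from the spectral gap centred at 0, is what makes \<open>S\<close>
  composed with any map of Lipschitz constant below \<beta> a contraction.\<close>

lemma finite_rank_modified_inverse:
  fixes A :: "'a::{real_inner, complete_space} \<Rightarrow> 'a"
  assumes "self_adjoint D A" and \<beta>: "0 < \<beta>" "\<beta> < b" and ess: "essential_spectrum D A \<inter> {-b<..<b} = {}"
  obtains K S where "bounded_linear K" "finite_dimensional (range K)" "bounded_linear S"
    "\<And>y. S y \<in> D" "\<And>y. A (S y) + K (S y) = y" "\<And>x. x \<in> D \<Longrightarrow> S (A x + K x) = x"
    "\<And>y. norm (S y) \<le> norm y / \<beta>"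
proof -
  have "\<mu> isolated_in spectrum D A \<and> finite_dimensional (eigenspace D A \<mu>)"
    if "\<mu> \<in> spectrum D A" "\<bar>\<mu>\<bar> < b" for \<mu>
  proof -
    have "\<mu> \<in> discrete_spectrum D A" using that ess by (auto simp: essential_spectrum_def abs_less_iff)
    then show ?thesis by (simp add: discrete_spectrum_def)
  qed
  then obtain K where K: "bounded_linear K" "finite_dimensional (range K)"
    "self_adjoint D (\<lambda>x. A x + K x)" "spectrum D (\<lambda>x. A x + K x) \<inter> {-\<beta>..\<beta>} = {}"
    using finite_rank_spectral_shift[OF assms(1) \<beta>(2)] by blast
  have gap: "{0 - \<beta><..<0 + \<beta>} \<subseteq> resolvent_set D (\<lambda>x. A x + K x)" using K(4) by (auto simp: spectrum_def)
  then have "0 \<in> resolvent_set D (\<lambda>x. A x + K x)" using \<beta> by auto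
  then obtain S where S: "bounded_linear S" "\<And>y. S y \<in> D" "\<And>y. A (S y) + K (S y) - 0 *\<^sub>R S y = y"
    "\<And>x. x \<in> D \<Longrightarrow> S (A x + K x - 0 *\<^sub>R x) = x"
    by (rule resolvent_setE) blast
  have "norm (S y) \<le> norm y / \<beta>" for y
    using spectral_gap_lower_bound[OF K(3) \<beta>(1) gap S(2), of y] S(3)[of y] \<beta>(1) by (simp add: field_simps)
  then show ?thesis using K S that[of K S] by simp
qed

section \<open>Semilinear equations with a finite-dimensional kernel at infinity\<close>

text \<open>A uniform factor \<open>q\<close> gives \<open>(1 - q) * dist (Z p) (Z p0) \<le> dist (g
  p (Z p0)) (g p0 (Z p0))\<close>, so continuity in the parameter is needed only at the fixed
  argument \<open>Z p0\<close>.\<close>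

lemma continuous_on_contraction_fixpoint:
  fixes g :: "'p::topological_space \<Rightarrow> 'a::metric_space \<Rightarrow> 'a"
  assumes q: "q < 1"
    and contr: "\<And>p x y. p \<in> U \<Longrightarrow> dist (g p x) (g p y) \<le> q * dist x y"
    and cont: "\<And>x. continuous_on U (\<lambda>p. g p x)"
    and fixp: "\<And>p. p \<in> U \<Longrightarrow> g p (Z p) = Z p"
  shows "continuous_on U Z"
  unfolding continuous_on
proof
  fix p0 assume p0: "p0 \<in> U"
  show "(Z \<longlongrightarrow> Z p0) (at p0 within U)"
  proof (rule tendstoI)
    fix e :: real assume e: "e > 0"
    have "((\<lambda>p. g p (Z p0)) \<longlongrightarrow> g p0 (Z p0)) (at p0 within U)"
      using cont p0 unfolding continuous_on by blast
    then have "\<forall>\<^sub>F p in at p0 within U. dist (g p (Z p0)) (g p0 (Z p0)) < e * (1 - q)"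
      by (rule tendstoD) (use e q in simp)
    moreover have "\<forall>\<^sub>F p in at p0 within U. p \<in> U"
      by (simp add: eventually_at_filter)
    ultimately show "\<forall>\<^sub>F p in at p0 within U. dist (Z p) (Z p0) < e"
    proof eventually_elim
      case (elim p)
      have "dist (Z p) (Z p0) = dist (g p (Z p)) (g p0 (Z p0))" using fixp elim p0 by simp
      also have "\<dots> \<le> dist (g p (Z p)) (g p (Z p0)) + dist (g p (Z p0)) (g p0 (Z p0))"
        by (rule dist_triangle)
      also have "\<dots> < q * dist (Z p) (Z p0) + e * (1 - q)"
        using contr[OF elim(2), of "Z p" "Z p0"] elim(1) by linarith
      finally have "(1 - q) * dist (Z p) (Z p0) < (1 - q) * e" by (simp add: algebra_simps)
      then show ?case using q by (simp add: mult_less_cancel_left)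
    qed
  qed
qed

text \<open>Polarisation with \<open>y\<close> parallel to \<open>B x\<close> and of the same length
  as \<open>x\<close>, followed by the parallelogram law.\<close>

lemma symmetric_form_bound_imp_norm_bound:
  fixes B :: "'a::real_inner \<Rightarrow> 'a"
  assumes B: "linear B" "\<And>x y. inner (B x) y = inner x (B y)"
    and \<rho>: "\<And>x. \<bar>inner (B x) x\<bar> \<le> \<rho> * (norm x)\<^sup>2"
  shows "norm (B x) \<le> \<rho> * norm x"
proof (cases "B x = 0 \<or> x = 0")
  case True
  have "0 \<le> \<rho>" if "x \<noteq> 0"
  proof -
    have "0 \<le> \<rho> * (norm x)\<^sup>2" using \<rho>[of x] by linarith
    then show ?thesis using that by (simp add: zero_le_mult_iff)
  qed
  then show ?thesis using True linear_0[OF B(1)] by (cases "x = 0") auto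
next
  case False
  define t where "t = norm x / norm (B x)"
  define y where "y = t *\<^sub>R B x"
  have y: "norm y = norm x" using False by (simp add: y_def t_def)
  have sq: "inner (B (x + y)) (x + y) - inner (B (x - y)) (x - y) = 4 * inner (B x) y"
    using B(2)[of y x] by (simp add: linear_add[OF B(1)] linear_diff[OF B(1)] inner_add_left inner_add_right
        inner_diff_left inner_diff_right inner_commute)
  have "4 * inner (B x) y \<le> \<rho> * (norm (x + y))\<^sup>2 + \<rho> * (norm (x - y))\<^sup>2"
    using \<rho>[of "x + y"] \<rho>[of "x - y"] sq by linarith
  also have "\<dots> = \<rho> * (2 * (norm x)\<^sup>2 + 2 * (norm y)\<^sup>2)"
    unfolding power2_norm_eq_inner
    by (simp add: inner_add_left inner_add_right inner_diff_left inner_diff_right inner_commute algebra_simps)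
  also have "\<dots> = 4 * (\<rho> * norm x * norm x)" by (simp add: y power2_eq_square)
  finally have "inner (B x) y \<le> \<rho> * norm x * norm x" by simp
  moreover have "inner (B x) y = norm x * norm (B x)"
    using False by (simp add: y_def t_def power2_norm_eq_inner[symmetric] power2_eq_square)
  ultimately have "norm x * norm (B x) \<le> norm x * (\<rho> * norm x)" by (simp add: mult_ac)
  then show ?thesis using False by (simp add: mult_le_cancel_left)
qed

lemma L_s_symmetric:
  assumes "B \<in> L_s b"
  shows "inner (B x) y = inner x (B y)"
  using assms self_adjoint_symmetric[of UNIV B x y] by (simp add: L_s_def)

lemma L_s_norm_bound:
  assumes B: "B \<in> L_s b" and b: "b > 0"
  obtains \<rho> where "0 \<le> \<rho>" "\<rho> < b" "\<And>x. norm (B x) \<le> \<rho> * norm x"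
proof -
  obtain \<delta>1 where d1: "\<delta>1 > 0" "positive_definite (\<lambda>x. (b - \<delta>1) *\<^sub>R x - B x)"
    using B by (auto simp: L_s_def)
  obtain \<delta>2 where d2: "\<delta>2 > 0" "positive_definite (\<lambda>x. B x - (- b + \<delta>2) *\<^sub>R x)"
    using B by (auto simp: L_s_def)
  have lin: "linear B" using B by (auto simp: L_s_def bounded_linear.linear)
  \<comment> \<open>The smaller margin serves both sides of the form; \<open>max 0\<close> provides
    \<open>0 \<le> \<rho>\<close> without comparing the margins with \<open>b\<close>.\<close>
  define \<rho> where "\<rho> = max 0 (b - min \<delta>1 \<delta>2)"
  have form: "\<bar>inner (B x) x\<bar> \<le> \<rho> * (norm x)\<^sup>2" for x
  proof (cases "x = 0")
    case False
    have "(b - \<delta>1) * (norm x)\<^sup>2 \<le> \<rho> * (norm x)\<^sup>2" "(b - \<delta>2) * (norm x)\<^sup>2 \<le> \<rho> * (norm x)\<^sup>2"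
      by (auto simp: \<rho>_def intro!: mult_right_mono)
    moreover have "inner (B x) x < (b - \<delta>1) * (norm x)\<^sup>2"
      using d1(2) False by (auto simp: positive_definite_def inner_diff_left power2_norm_eq_inner)
    moreover have "- ((b - \<delta>2) * (norm x)\<^sup>2) < inner (B x) x"
      using d2(2) False by (auto simp: positive_definite_def inner_diff_left power2_norm_eq_inner algebra_simps)
    ultimately show ?thesis by linarith
  qed (simp add: linear_0[OF lin])
  show ?thesis
  proof (rule that)
    show "norm (B x) \<le> \<rho> * norm x" for x
      by (rule symmetric_form_bound_imp_norm_bound[OF lin L_s_symmetric[OF B] form])
  qed (use d1 d2 b in \<open>auto simp: \<rho>_def\<close>)
qed

text \<open>\<open>S\<close> is the bounded inverse of \<open>A + K\<close> with \<open>K\<close> of finite rank, so that the equation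
  \<open>A z = G z\<close> becomes \<open>z = S (G z) + S (K z)\<close>: a contraction plus a finite rank operator.\<close>

locale modified_inverse =
  fixes D :: "'a::{real_inner, complete_space} set" and A K S :: "'a \<Rightarrow> 'a" and \<beta> :: real
  assumes sa: "self_adjoint D A"
    and K: "bounded_linear K" "finite_dimensional (range K)"
    and S: "bounded_linear S"
    and S_D: "S y \<in> D"
    and S_right: "A (S y) + K (S y) = y"
    and S_left: "x \<in> D \<Longrightarrow> S (A x + K x) = x"
    and \<beta>: "\<beta> > 0"
    and S_norm: "norm (S y) \<le> norm y / \<beta>"
begin

sublocale K: bounded_linear K by (rule K)
sublocale S: bounded_linear S by (rule S)

lemmas lin = self_adjoint_linear[OF sa]

lemma equation_iff: "z = S (y + K z) \<longleftrightarrow> z \<in> D \<and> A z = y"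
proof
  assume z: "z = S (y + K z)"
  then have "z \<in> D" using S_D by metis
  moreover have "A z + K z = y + K z" using S_right[of "y + K z"] z by simp
  ultimately show "z \<in> D \<and> A z = y" by simp
qed (use S_left in auto)

lemma bounded_linear_SK: "bounded_linear (\<lambda>x. S (K x))"
  by (rule bounded_linear_compose[OF S K(1)])

lemma finite_dimensional_range_SK: "finite_dimensional (range (\<lambda>x. S (K x)))"
proof -
  obtain T where T: "finite T" "range K \<subseteq> span T" using K(2) by (auto simp: finite_dimensional_def)
  have "range (\<lambda>x. S (K x)) \<subseteq> S ` span T" using T(2) by auto
  also have "\<dots> = span (S ` T)" by (rule linear_span_image[OF S.linear, symmetric])
  finally show ?thesis using T(1) by (auto simp: finite_dimensional_def)
qed

lemma contraction_fixpoint: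
  assumes G: "\<And>x y. norm (G x - G y) \<le> l * norm (x - y)" and l: "0 \<le> l" "l < \<beta>"
  shows "norm (S (G x) - S (G y)) \<le> l / \<beta> * norm (x - y)" "\<exists>!z. S (G z) + v = z"
proof -
  show contr: "norm (S (G x) - S (G y)) \<le> l / \<beta> * norm (x - y)" for x y
  proof -
    have "norm (S (G x) - S (G y)) \<le> norm (G x - G y) / \<beta>" using S_norm[of "G x - G y"] by (simp add: S.diff)
    also have "\<dots> \<le> (l * norm (x - y)) / \<beta>" using G \<beta> by (intro divide_right_mono) auto
    finally show ?thesis by simp
  qed
  show "\<exists>!z. S (G z) + v = z"
    using contr l \<beta> by (intro banach_fix_type[of "l / \<beta>"]) (auto simp: dist_norm)
qed

section \<open>The kernel of \<open>A - B\<close> and bounded perturbations of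
  \<open>B\<close>\<close>

context
  fixes B :: "'a \<Rightarrow> 'a" and \<rho> :: real
  assumes B: "bounded_linear B" "\<And>x y. inner (B x) y = inner x (B y)"
    and \<rho>: "0 \<le> \<rho>" "\<rho> < \<beta>" "\<And>x. norm (B x) \<le> \<rho> * norm x"
begin

interpretation B: bounded_linear B by (rule B)

definition kern :: "'a set" where "kern = {x \<in> D. A x = B x}"

lemma B_lipschitz: "norm (B x - B y) \<le> \<rho> * norm (x - y)"
  using \<rho>(3)[of "x - y"] by (simp add: B.diff)

lemma subspace_kern: "subspace kern"
proof -
  have "0 \<in> D" by (intro subspace_0 linear_operator_subspace[OF lin])
  then have "A 0 = 0" using linear_operator_diff[OF lin, of 0 0] by simp
  then show ?thesis
    using lin by (auto simp: kern_def linear_operator_def subspace_def B.add B.scaleR B.zero)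
qed

text \<open>\<open>S \<circ> K\<close> is injective on the kernel: an element \<open>w\<close> with
  \<open>S (K w) = 0\<close> satisfies \<open>w = S (B w)\<close>, and the contraction
  \<open>S \<circ> B\<close> fixes only 0.\<close>

lemma finite_dimensional_kern: "finite_dimensional kern"
proof (rule finite_dimensional_inj_on_preimage[OF bounded_linear.linear[OF bounded_linear_SK] subspace_kern])
  show "inj_on (\<lambda>x. S (K x)) kern"
  proof (rule inj_onI)
    fix x y assume xy: "x \<in> kern" "y \<in> kern" "S (K x) = S (K y)"
    define w where "w = x - y"
    have "w \<in> kern" unfolding w_def using xy by (intro subspace_diff[OF subspace_kern])
    then have "w = S (B w + K w)" unfolding equation_iff by (auto simp: kern_def)
    moreover have "S (K w) = 0" using xy(3) by (simp add: w_def K.diff S.diff)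
    ultimately have "w = S (B w)" by (simp add: S.add)
    then have "norm w \<le> \<rho> / \<beta> * norm w"
      using contraction_fixpoint(1)[OF B_lipschitz \<rho>(1,2), of w 0] by (simp add: B.zero S.zero)
    moreover have "\<rho> / \<beta> < 1" using \<rho> \<beta> by simp
    ultimately have "norm w = 0" by (metis less_eq_real_def mult_le_cancel_right1 norm_ge_zero not_le)
    then show "x = y" by (simp add: w_def)
  qed
  show "finite_dimensional ((\<lambda>x. S (K x)) ` kern)"
    using finite_dimensional_range_SK unfolding finite_dimensional_def by blast
qed

text \<open>Compactness comes only from the finite rank part. For unit vectors with
  \<open>(A - B) u\<close> tending to 0, a subsequence of \<open>S (K u)\<close> converges, and the
  contraction then forces \<open>u\<close> itself to converge. The limit is a unit vector in the
  kernel that is orthogonal to the kernel.\<close>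

lemma lower_bound_orthogonal_kern:
  obtains C where "C > 0"
    "\<And>w. w \<in> D \<Longrightarrow> (\<And>n. n \<in> kern \<Longrightarrow> inner w n = 0) \<Longrightarrow> norm w \<le> C * norm (A w - B w)"
proof -
  have "\<exists>C>0. \<forall>w\<in>D. (\<forall>n\<in>kern. inner w n = 0) \<longrightarrow> norm w \<le> C * norm (A w - B w)"
  proof (rule ccontr)
    assume "\<not> ?thesis"
    then have "\<exists>w\<in>D. (\<forall>n\<in>kern. inner w n = 0) \<and> real (Suc k) * norm (A w - B w) < norm w" for k
      by (auto simp: not_le dest!: spec[of _ "real (Suc k)"])
    then obtain w where w: "\<And>k. w k \<in> D" "\<And>k n. n \<in> kern \<Longrightarrow> inner (w k) n = 0"
      "\<And>k. real (Suc k) * norm (A (w k) - B (w k)) < norm (w k)" by metis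
    define u where "u k = (1 / norm (w k)) *\<^sub>R w k" for k
    have w_pos: "norm (w k) > 0" for k
    proof -
      have "0 \<le> real (Suc k) * norm (A (w k) - B (w k))" by (intro mult_nonneg_nonneg) auto
      then show ?thesis using w(3)[of k] by linarith
    qed
    have u_D: "u k \<in> D" for k
      unfolding u_def by (intro subspace_scale[OF linear_operator_subspace[OF lin]] w)
    have u_norm: "norm (u k) = 1" for k using w_pos[of k] by (simp add: u_def)
    have u_orth: "inner (u k) n = 0" if "n \<in> kern" for k n using w(2)[OF that] by (simp add: u_def)
    have Lu: "A (u k) - B (u k) = (1 / norm (w k)) *\<^sub>R (A (w k) - B (w k))" for k
      using lin w(1)[of k] by (simp add: u_def linear_operator_def B.scaleR scaleR_diff_right)
    have Lu_norm: "norm (A (u k) - B (u k)) \<le> inverse (real (Suc k))" for k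
      using w(3)[of k] w_pos[of k] unfolding Lu norm_scaleR by (simp add: field_simps)
    have Lu_lim: "(\<lambda>k. A (u k) - B (u k)) \<longlonglongrightarrow> 0"
      by (rule Lim_null_comparison[OF _ LIMSEQ_inverse_real_of_nat]) (use Lu_norm in simp)
    obtain E where E: "finite E" "orthonormal E" "span E = range (\<lambda>x. S (K x))"
      using finite_dimensional_orthonormal_basis[OF finite_dimensional_range_SK
          linear_subspace_image[OF bounded_linear.linear[OF bounded_linear_SK] subspace_UNIV]] by metis
    obtain k0 where k0: "\<And>x. norm (S (K x)) \<le> norm x * k0"
      using bounded_linear.bounded[OF bounded_linear_SK] by blast
    obtain l r where r: "strict_mono r" "((\<lambda>k. S (K (u k))) \<circ> r) \<longlonglongrightarrow> l"
    proof (rule bounded_seq_in_span_convergent_subseq[OF E(1,2), of "\<lambda>k. S (K (u k))" k0])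
      show "S (K (u n)) \<in> span E" for n using E(3) by auto
      show "norm (S (K (u n))) \<le> k0" for n using k0[of "u n"] u_norm by simp
    qed
    \<comment> \<open>\<open>z\<close> is the predicted limit of \<open>u \<circ> r\<close>: the
      equation of \<open>u (r k)\<close> with the error \<open>h k\<close> dropped and
      \<open>S (K (u (r k)))\<close> replaced by its limit \<open>l\<close>.\<close>
    obtain z where z: "S (B z) + l = z"
      using contraction_fixpoint(2)[OF B_lipschitz \<rho>(1,2), of l] by blast
    define h where "h k = (S (K (u (r k))) - l) + S (A (u (r k)) - B (u (r k)))" for k
    have "h \<longlonglongrightarrow> 0 + S 0"
      unfolding h_def
    proof (intro tendsto_add)
      show "(\<lambda>k. S (K (u (r k))) - l) \<longlonglongrightarrow> 0" using r(2) by (simp add: LIM_zero o_def)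
      show "(\<lambda>k. S (A (u (r k)) - B (u (r k)))) \<longlonglongrightarrow> S 0"
        using LIMSEQ_subseq_LIMSEQ[OF Lu_lim r(1)] by (intro S.tendsto) (simp add: o_def)
    qed
    then have h_lim: "h \<longlonglongrightarrow> 0" by (simp add: S.zero)
    have dist_bound: "norm (u (r k) - z) \<le> norm (h k) * (\<beta> / (\<beta> - \<rho>))" for k
    proof -
      let ?v = "u (r k)"
      have "?v = S (A ?v + K ?v)" using S_left[OF u_D] by simp
      also have "A ?v + K ?v = B ?v + K ?v + (A ?v - B ?v)" by simp
      finally have "?v - z = (S (B ?v) - S (B z)) + h k"
        using z unfolding h_def S.add by (simp add: algebra_simps)
      then have "norm (?v - z) \<le> norm (S (B ?v) - S (B z)) + norm (h k)"
        using norm_triangle_ineq by metis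
      also have "\<dots> \<le> \<rho> / \<beta> * norm (?v - z) + norm (h k)"
        using contraction_fixpoint(1)[OF B_lipschitz \<rho>(1,2)] by simp
      finally show ?thesis using \<rho> \<beta> by (simp add: field_simps)
    qed
    have "(\<lambda>k. u (r k) - z) \<longlonglongrightarrow> 0"
    proof (rule Lim_null_comparison)
      show "\<forall>\<^sub>F k in sequentially. norm (u (r k) - z) \<le> norm (h k) * (\<beta> / (\<beta> - \<rho>))"
        by (intro always_eventually allI dist_bound)
      show "(\<lambda>k. norm (h k) * (\<beta> / (\<beta> - \<rho>))) \<longlonglongrightarrow> 0"
        by (intro tendsto_mult_left_zero tendsto_norm_zero h_lim)
    qed
    then have u_lim: "(\<lambda>k. u (r k)) \<longlonglongrightarrow> z" by (simp add: LIM_zero_cancel)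
    then have "(\<lambda>k. S (K (u (r k)))) \<longlonglongrightarrow> S (K z)" by (intro S.tendsto K.tendsto)
    then have "l = S (K z)" using r(2) LIMSEQ_unique by (auto simp: o_def)
    then have "z = S (B z + K z)" using z by (simp add: S.add)
    then have "z \<in> kern" unfolding equation_iff by (simp add: kern_def)
    have "(\<lambda>k. inner (u (r k)) z) \<longlonglongrightarrow> inner z z" by (intro tendsto_inner u_lim tendsto_const)
    then have "inner z z = 0" using u_orth[OF \<open>z \<in> kern\<close>] by (simp add: LIMSEQ_const_iff)
    moreover have "(\<lambda>k. norm (u (r k))) \<longlonglongrightarrow> norm z" by (intro tendsto_norm u_lim)
    ultimately show False by (simp add: u_norm LIMSEQ_const_iff)
  qed
  then show ?thesis using that by blast
qed

text \<open>Decompose \<open>z = n + w\<close> along the kernel of \<open>A - B\<close>. The component \<open>w\<close> stays bounded, so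
  \<open>(r z, n)\<close> has the sign of \<open>(r z, z)\<close> when \<open>z\<close> is large, while the equation tested
  with \<open>n\<close> forces \<open>s (r z, n) + (1 - s) \<sigma> c (n, n) = 0\<close>.\<close>

lemma a_priori_bound:
  fixes \<sigma> c C M :: real
  assumes \<sigma>: "\<sigma> = 1 \<or> \<sigma> = -1"
    and r: "\<And>z. norm (r z) \<le> M"
    and coercive: "filterlim (\<lambda>z. \<sigma> * inner (r z) z) at_top at_infinity"
    and C: "C > 0"
      "\<And>w. w \<in> D \<Longrightarrow> (\<And>n. n \<in> kern \<Longrightarrow> inner w n = 0) \<Longrightarrow> norm w \<le> C * norm (A w - B w)"
    and c: "0 < c" "c * C \<le> 1 / 2"
  obtains R where "\<And>z s. z \<in> D \<Longrightarrow> s \<in> {0..1} \<Longrightarrow>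
    A z = B z + s *\<^sub>R r z + ((1 - s) * \<sigma> * c) *\<^sub>R z \<Longrightarrow> norm z \<le> R"
proof -
  have M: "M \<ge> 0" using r[of 0] norm_ge_zero order_trans by blast
  have "\<forall>\<^sub>F z in at_infinity. 2 * C * M\<^sup>2 + 1 \<le> \<sigma> * inner (r z) z"
    using coercive unfolding filterlim_at_top by blast
  \<comment> \<open>The threshold exceeds by 1 the bound \<open>M * (2 * C * M)\<close> obtained
    below for the contribution of \<open>w\<close> to \<open>inner (r z) z\<close>.\<close>
  then obtain R where R: "\<And>z. norm z \<ge> R \<Longrightarrow> 2 * C * M\<^sup>2 + 1 \<le> \<sigma> * inner (r z) z"
    unfolding eventually_at_infinity by blast
  obtain E where E: "finite E" "orthonormal E" "span E = kern"
    using finite_dimensional_orthonormal_basis[OF finite_dimensional_kern subspace_kern] by metis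
  show ?thesis
  proof (rule that[of R], rule ccontr)
    fix z s assume z: "z \<in> D" and s: "s \<in> {0..1::real}"
      and eq: "A z = B z + s *\<^sub>R r z + ((1 - s) * \<sigma> * c) *\<^sub>R z" and "\<not> norm z \<le> R"
    define n w where "n = proj E z" and "w = z - n"
    have n: "n \<in> kern" using proj_in_span[of E z] by (simp add: n_def E(3))
    then have nD: "n \<in> D" "A n = B n" by (auto simp: kern_def)
    have wD: "w \<in> D" unfolding w_def by (intro subspace_diff[OF linear_operator_subspace[OF lin]] z nD)
    have w_orth: "inner w m = 0" if "m \<in> kern" for m
      using inner_diff_proj[OF E(1,2)] that by (simp add: w_def n_def E(3))
    have zw: "z = n + w" by (simp add: w_def)
    have Lw: "A w - B w = s *\<^sub>R r z + ((1 - s) * \<sigma> * c) *\<^sub>R (n + w)"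
      using eq nD(2) linear_operator_diff[OF lin z nD(1)]
      by (simp add: w_def B.diff algebra_simps)
    \<comment> \<open>By symmetry \<open>A - B\<close> maps into the orthogonal complement of its
      kernel, so the term with \<open>n\<close> drops out of the estimate for
      \<open>w\<close>.\<close>
    have L_orth: "inner (A w - B w) m = 0" if "m \<in> kern" for m
    proof -
      have "inner (A w) m = inner w (B m)"
        using self_adjoint_symmetric[OF sa wD, of m] that by (simp add: kern_def)
      then show ?thesis by (simp add: inner_diff_left B(2))
    qed
    have "\<bar>(1 - s) * \<sigma> * c\<bar> \<le> c" using \<sigma> s c(1) by (auto simp: abs_mult mult_left_le_one_le)
    have "(norm (A w - B w))\<^sup>2 = inner (A w - B w) (s *\<^sub>R r z + ((1 - s) * \<sigma> * c) *\<^sub>R w)"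
    proof -
      have "(norm (A w - B w))\<^sup>2 = inner (A w - B w) (s *\<^sub>R r z + ((1 - s) * \<sigma> * c) *\<^sub>R (n + w))"
        unfolding power2_norm_eq_inner by (subst (2) Lw) simp
      then show ?thesis using L_orth[OF n] by (simp add: inner_add_right)
    qed
    also have "\<dots> \<le> norm (A w - B w) * norm (s *\<^sub>R r z + ((1 - s) * \<sigma> * c) *\<^sub>R w)"
      by (rule norm_cauchy_schwarz)
    also have "\<dots> \<le> norm (A w - B w) * (M + c * norm w)"
    proof (rule mult_left_mono)
      have "norm (s *\<^sub>R r z) \<le> M" using s r[of z] mult_left_le_one_le[of "norm (r z)" s] by simp
      moreover have "norm (((1 - s) * \<sigma> * c) *\<^sub>R w) \<le> c * norm w"
        unfolding norm_scaleR by (rule mult_right_mono) (fact, simp)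
      ultimately show "norm (s *\<^sub>R r z + ((1 - s) * \<sigma> * c) *\<^sub>R w) \<le> M + c * norm w"
        by (rule norm_triangle_mono)
    qed simp
    finally have Lw_norm: "norm (A w - B w) \<le> M + c * norm w"
      using M c(1) by (cases "A w = B w") (auto simp: power2_eq_square)
    \<comment> \<open>\<open>c * C \<le> 1 / 2\<close> lets half of \<open>norm w\<close> be
      absorbed on the left.\<close>
    have "norm w \<le> C * norm (A w - B w)" by (rule C(2)[OF wD w_orth])
    also have "\<dots> \<le> C * (M + c * norm w)" using Lw_norm C(1) by (intro mult_left_mono) auto
    also have "\<dots> \<le> C * M + 1 / 2 * norm w"
      using mult_right_mono[OF c(2), of "norm w"] by (simp add: algebra_simps)
    finally have w_norm: "norm w \<le> 2 * C * M" by simp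
    have "\<bar>inner (r z) w\<bar> \<le> M * (2 * C * M)"
      using Cauchy_Schwarz_ineq2[of "r z" w] mult_mono[OF r[of z] w_norm M norm_ge_zero] by linarith
    moreover have "2 * C * M\<^sup>2 + 1 \<le> \<sigma> * inner (r z) z" using R \<open>\<not> norm z \<le> R\<close> by simp
    moreover have "\<sigma> * inner (r z) z = \<sigma> * inner (r z) n + \<sigma> * inner (r z) w"
      by (simp add: zw inner_add_right distrib_left)
    moreover have "\<bar>\<sigma> * inner (r z) w\<bar> = \<bar>inner (r z) w\<bar>" using \<sigma> by auto
    ultimately have rn: "\<sigma> * inner (r z) n > 0" by (simp add: power2_eq_square algebra_simps)
    have "0 = \<sigma> * inner (A w - B w) n" using L_orth[OF n] by simp
    also have "\<dots> = s * (\<sigma> * inner (r z) n) + (1 - s) * c * (\<sigma> * \<sigma>) * inner n n"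
      unfolding Lw using w_orth[OF n] by (simp add: inner_add_left algebra_simps)
    also have "\<sigma> * \<sigma> = 1" using \<sigma> by auto
    finally have sum0: "s * (\<sigma> * inner (r z) n) + (1 - s) * c * inner n n = 0" by simp
    have "s * (\<sigma> * inner (r z) n) \<ge> 0" "(1 - s) * c * inner n n \<ge> 0"
      using s rn c by (auto intro!: mult_nonneg_nonneg)
    \<comment> \<open>The first product forces \<open>s = 0\<close>, the second then
      \<open>n = 0\<close>, against \<open>\<sigma> * inner (r z) n > 0\<close>.\<close>
    with sum0 have "s * (\<sigma> * inner (r z) n) = 0" "(1 - s) * c * inner n n = 0" by linarith+
    then have "n = 0" using rn c by auto
    then show False using rn by simp
  qed
qed

text \<open>A zero \<open>v\<close> of the reduced map is a solution: \<open>v = S (K z)\<close>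
  turns \<open>z = S (G z) + v\<close> into \<open>z = S (G z + K z)\<close>. Inverting the linear
  problem at \<open>s = 0\<close> makes the deformation start at the identity.\<close>

lemma semilinear_solvable:
  fixes \<sigma> l M :: real
  assumes F: "\<And>x y. norm (F x - F y) \<le> l * norm (x - y)" and l: "0 \<le> l" "l < \<beta>"
    and F_eq: "\<And>z. F z = B z + r z"
    and r: "\<And>z. norm (r z) \<le> M"
    and \<sigma>: "\<sigma> = 1 \<or> \<sigma> = -1"
    and coercive: "filterlim (\<lambda>z. \<sigma> * inner (r z) z) at_top at_infinity"
  shows "\<exists>z\<in>D. A z = F z"
proof -
  obtain C where C: "C > 0"
    "\<And>w. w \<in> D \<Longrightarrow> (\<And>n. n \<in> kern \<Longrightarrow> inner w n = 0) \<Longrightarrow> norm w \<le> C * norm (A w - B w)"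
    using lower_bound_orthogonal_kern by blast
  \<comment> \<open>The first entry serves the bound on solutions; the second keeps the Lipschitz
    constant \<open>\<rho> + c\<close> of the linear end below \<beta>.\<close>
  define c where "c = min (1 / (2 * C)) ((\<beta> - \<rho>) / 2)"
  have c: "0 < c" "c * C \<le> 1 / 2" "\<rho> + c < \<beta>"
  proof -
    show "0 < c" using C(1) \<rho> by (simp add: c_def)
    have "c \<le> (\<beta> - \<rho>) / 2" unfolding c_def by (rule min.cobounded2)
    also have "\<dots> < \<beta> - \<rho>" using \<rho>(2) by simp
    finally show "\<rho> + c < \<beta>" by simp
    have "c * C \<le> 1 / (2 * C) * C" using C(1) by (intro mult_right_mono) (auto simp: c_def)
    then show "c * C \<le> 1 / 2" using C(1) by simp
  qed
  obtain R where R: "\<And>z s. z \<in> D \<Longrightarrow> s \<in> {0..1} \<Longrightarrow>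
      A z = B z + s *\<^sub>R r z + ((1 - s) * \<sigma> * c) *\<^sub>R z \<Longrightarrow> norm z \<le> R"
    by (rule a_priori_bound[OF \<sigma> r coercive C c(1,2)]) blast+
  define G where "G s z = s *\<^sub>R F z + (1 - s) *\<^sub>R (B z + (\<sigma> * c) *\<^sub>R z)" for s z
  have G_eq: "G s z = B z + s *\<^sub>R r z + ((1 - s) * \<sigma> * c) *\<^sub>R z" for s z
    by (simp add: G_def F_eq algebra_simps)
  define l' where "l' = max l (\<rho> + c)"
  have l': "0 \<le> l'" "l' < \<beta>" using l c by (auto simp: l'_def)
  have G_lip: "norm (G s x - G s y) \<le> l' * norm (x - y)" if s: "s \<in> {0..1}" for s x y
  proof -
    have eq: "G s x - G s y = s *\<^sub>R (F x - F y) + (1 - s) *\<^sub>R ((B x - B y) + (\<sigma> * c) *\<^sub>R (x - y))"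
      by (simp add: G_def algebra_simps)
    have "norm (F x - F y) \<le> l' * norm (x - y)"
      using F[of x y] mult_right_mono[of l l' "norm (x - y)"] by (simp add: l'_def)
    moreover have "norm ((B x - B y) + (\<sigma> * c) *\<^sub>R (x - y)) \<le> l' * norm (x - y)"
    proof -
      have "\<bar>\<sigma> * c\<bar> = c" using \<sigma> c(1) by auto
      then have "norm ((B x - B y) + (\<sigma> * c) *\<^sub>R (x - y)) \<le> norm (B x - B y) + c * norm (x - y)"
        using norm_triangle_ineq[of "B x - B y" "(\<sigma> * c) *\<^sub>R (x - y)"] by (simp only: norm_scaleR)
      also have "\<dots> \<le> (\<rho> + c) * norm (x - y)" using B_lipschitz[of x y] by (simp add: distrib_right)
      also have "\<dots> \<le> l' * norm (x - y)" by (intro mult_right_mono) (auto simp: l'_def)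
      finally show ?thesis .
    qed
    ultimately have "s * norm (F x - F y) + (1 - s) * norm ((B x - B y) + (\<sigma> * c) *\<^sub>R (x - y))
        \<le> s * (l' * norm (x - y)) + (1 - s) * (l' * norm (x - y))"
      using s by (intro add_mono mult_left_mono) auto
    moreover have "norm (G s x - G s y) \<le>
        s * norm (F x - F y) + (1 - s) * norm ((B x - B y) + (\<sigma> * c) *\<^sub>R (x - y))"
      unfolding eq using s
        norm_triangle_ineq[of "s *\<^sub>R (F x - F y)" "(1 - s) *\<^sub>R ((B x - B y) + (\<sigma> * c) *\<^sub>R (x - y))"]
      by simp
    ultimately show ?thesis by (simp add: algebra_simps)
  qed
  define Z where "Z p = (THE z. S (G (fst p) z) + snd p = z)" for p
  have Z: "S (G s (Z (s, v))) + v = Z (s, v)" if "s \<in> {0..1}" for s v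
    unfolding Z_def fst_conv snd_conv by (rule theI') (rule contraction_fixpoint(2)[OF G_lip[OF that] l'])
  have Z_unique: "z = Z (s, v)" if "s \<in> {0..1}" "S (G s z) + v = z" for s v z
    using contraction_fixpoint(2)[OF G_lip[OF that(1)] l', of v] Z[OF that(1), of v] that(2) by blast
  have Z_sol: "Z (s, v) \<in> D \<and> A (Z (s, v)) = G s (Z (s, v))"
    if "s \<in> {0..1}" "v = S (K (Z (s, v)))" for s v
  proof -
    have "Z (s, v) = S (G s (Z (s, v)) + K (Z (s, v)))" using Z[OF that(1), of v] that(2) by (simp add: S.add)
    then show ?thesis by (simp only: equation_iff)
  qed
  have Z_bound: "norm (Z (s, v)) \<le> R" if "s \<in> {0..1}" "v = S (K (Z (s, v)))" for s v
    using Z_sol[OF that] R[OF _ that(1)] by (simp add: G_eq)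
  have Z_cont: "continuous_on ({0..1} \<times> UNIV) Z"
  proof (rule continuous_on_contraction_fixpoint[where q = "l' / \<beta>" and g = "\<lambda>p z. S (G (fst p) z) + snd p"])
    show "l' / \<beta> < 1" using l' \<beta> by simp
    show "dist (S (G (fst p) x) + snd p) (S (G (fst p) y) + snd p) \<le> l' / \<beta> * dist x y"
      if "p \<in> {0..1} \<times> UNIV" for p x y
      using contraction_fixpoint(1)[OF G_lip l', of "fst p" x y] that by (auto simp: dist_norm)
    show "continuous_on ({0..1} \<times> UNIV) (\<lambda>p. S (G (fst p) x) + snd p)" for x
      unfolding G_def by (intro continuous_intros S.continuous_on)
    show "S (G (fst p) (Z p)) + snd p = Z p" if "p \<in> {0..1} \<times> UNIV" for p
      using Z[of "fst p" "snd p"] that by auto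
  qed
  obtain E where E: "finite E" "orthonormal E" "span E = range (\<lambda>x. S (K x))"
    using finite_dimensional_orthonormal_basis[OF finite_dimensional_range_SK
        linear_subspace_image[OF bounded_linear.linear[OF bounded_linear_SK] subspace_UNIV]] by metis
  have SK_E: "S (K x) \<in> span E" for x using E(3) by auto
  define T where "T v = v - S (K (Z (0, v)))" for v
  have Z0_add: "Z (0, x + y) = Z (0, x) + Z (0, y)" for x y
  proof (rule Z_unique[symmetric])
    have "S (G 0 (Z (0, x) + Z (0, y))) + (x + y) = (S (G 0 (Z (0, x))) + x) + (S (G 0 (Z (0, y))) + y)"
      by (simp add: G_def B.add S.add scaleR_add_right)
    also have "\<dots> = Z (0, x) + Z (0, y)" using Z[of 0] by simp
    finally show "S (G 0 (Z (0, x) + Z (0, y))) + (x + y) = Z (0, x) + Z (0, y)" .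
  qed simp
  have Z0_scale: "Z (0, a *\<^sub>R x) = a *\<^sub>R Z (0, x)" for a x
  proof (rule Z_unique[symmetric])
    have "S (G 0 (a *\<^sub>R Z (0, x))) + a *\<^sub>R x = a *\<^sub>R (S (G 0 (Z (0, x))) + x)"
      by (simp add: G_def B.scaleR S.add S.scaleR scaleR_add_right mult.commute)
    also have "\<dots> = a *\<^sub>R Z (0, x)" using Z[of 0 x] by simp
    finally show "S (G 0 (a *\<^sub>R Z (0, x))) + a *\<^sub>R x = a *\<^sub>R Z (0, x)" .
  qed simp
  have T_lin: "linear T"
    unfolding T_def
    by (intro linearI) (simp_all add: Z0_add Z0_scale K.add K.scaleR S.add S.scaleR algebra_simps)
  \<comment> \<open>Solutions at \<open>s = 0\<close> form a linear space and are bounded by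
    \<open>R\<close>, so the bound itself yields invertibility at the linear end.\<close>
  have T_ker: "v = 0" if "T v = 0" for v
  proof -
    have v: "v = S (K (Z (0, v)))" using that by (simp add: T_def)
    have "a * norm (Z (0, v)) \<le> R" if "a > 0" for a
    proof -
      have "T (a *\<^sub>R v) = 0" using \<open>T v = 0\<close> linear_scale[OF T_lin] by simp
      then have "norm (Z (0, a *\<^sub>R v)) \<le> R" by (intro Z_bound) (simp_all add: T_def)
      then show ?thesis using that by (simp add: Z0_scale)
    qed
    note bound = this
    have "Z (0, v) = 0"
    proof (rule ccontr)
      assume "Z (0, v) \<noteq> 0"
      then have nz: "norm (Z (0, v)) > 0" by simp
      have "(\<bar>R\<bar> + 1) / norm (Z (0, v)) * norm (Z (0, v)) \<le> R" using nz by (intro bound divide_pos_pos) auto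
      then show False using nz by simp
    qed
    then show ?thesis using v by (simp add: K.zero S.zero)
  qed
  have T_E: "T ` span E \<subseteq> span E" unfolding T_def using SK_E by (auto intro: span_diff)
  have T_inj: "inj_on T (span E)"
  proof (rule inj_onI)
    fix x y assume "T x = T y"
    then show "x = y" using T_ker[of "x - y"] by (simp add: linear_diff[OF T_lin])
  qed
  have T_surj: "T ` span E = span E" by (rule linear_inj_on_imp_surj_on_span[OF E(1) T_lin T_E T_inj])
  obtain g where g: "range g \<subseteq> span E" "linear g" "\<And>v. v \<in> span E \<Longrightarrow> g (T v) = v"
    using linear_exists_left_inverse_on[OF T_lin subspace_span T_inj] by blast
  \<comment> \<open>\<open>g\<close> is only an algebraic left inverse. Applying it after projection
    to the span leaves a finite sum of inner products, which is visibly continuous.\<close>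
  define J where "J v = (\<Sum>e\<in>E. inner v e *\<^sub>R g e)" for v
  have J_g: "J v = g v" if "v \<in> span E" for v
  proof -
    have "g v = g (\<Sum>e\<in>E. inner v e *\<^sub>R e)" using proj_id[OF E(1,2) that] by (simp add: proj_def)
    also have "\<dots> = J v" by (simp add: J_def linear_sum[OF g(2)] linear_scale[OF g(2)])
    finally show ?thesis by simp
  qed
  define H where "H s v = J (v - S (K (Z (s, v))))" for s v
  obtain k where k: "\<And>x. norm (S (K x)) \<le> norm x * k" "k > 0"
    using bounded_linear.pos_bounded[OF bounded_linear_SK] by blast
  have H_zero: "v = S (K (Z (s, v)))" if "v \<in> span E" "H s v = 0" for s v
  proof -
    have "v - S (K (Z (s, v))) \<in> span E" using that(1) SK_E by (intro span_diff)
    moreover then obtain u where u: "u \<in> span E" "v - S (K (Z (s, v))) = T u" using T_surj by (metis imageE)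
    ultimately have "u = 0" using that(2) J_g g(3) unfolding H_def by metis
    then show ?thesis using u linear_0[OF T_lin] by simp
  qed
  have "\<exists>v\<in>span E. H 1 v = 0"
  \<comment> \<open>A zero satisfies \<open>v = S (K z)\<close> with \<open>norm z \<le> R\<close>,
    hence has norm at most \<open>\<bar>R\<bar> * k\<close>; the sphere is taken just
    outside.\<close>
  proof (rule homotopy_from_id_has_zero[OF E(1,2), of H "\<bar>R\<bar> * k + 1"])
    have "continuous_on ({0..1} \<times> span E) (\<lambda>p. Z p)" by (rule continuous_on_subset[OF Z_cont]) auto
    then have "continuous_on ({0..1} \<times> span E) (\<lambda>p. J (snd p - S (K (Z p))))"
      unfolding J_def by (intro continuous_intros S.continuous_on K.continuous_on)
    then show "continuous_on ({0..1} \<times> span E) (\<lambda>(s, v). H s v)" by (simp add: H_def case_prod_unfold)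
    show "H s v \<in> span E" for s v
      unfolding H_def J_def using g(1) by (intro span_sum span_scale) auto
    show "H 0 v = v" if "v \<in> span E" for v
      using J_g[of "T v"] g(3)[OF that] T_E that by (auto simp: H_def T_def)
    show "0 < \<bar>R\<bar> * k + 1" using k(2) by (simp add: add_nonneg_pos)
    show "H s v \<noteq> 0" if "s \<in> {0..1}" "v \<in> span E" "norm v = \<bar>R\<bar> * k + 1" for s v
    proof
      assume "H s v = 0"
      then have v: "v = S (K (Z (s, v)))" by (rule H_zero[OF that(2)])
      then have "norm v \<le> norm (Z (s, v)) * k" using k(1) by metis
      also have "\<dots> \<le> \<bar>R\<bar> * k" using Z_bound[OF that(1) v] k(2) by (intro mult_right_mono) auto
      finally show False using that(3) by simp
    qed
  qed
  then obtain v where "v \<in> span E" "H 1 v = 0" by blast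
  then have "v = S (K (Z (1, v)))" by (rule H_zero)
  from Z_sol[OF _ this] show ?thesis by (auto simp: G_def)
qed

end

end

theorem theorem3p6:
  fixes A :: "'a::{real_inner, complete_space} \<Rightarrow> 'a" and D :: "'a set"
    and F :: "'a \<Rightarrow> real" and F' :: "'a \<Rightarrow> 'a" and b :: real
  assumes separable: "separable_space (euclidean :: 'a topology)"
    and infinite_dim: "\<not> finite_dimensional (UNIV :: 'a set)"
    and b: "b > 0"
    and A: "(D, A) \<in> O0e b"
    and gradient: "\<And>z. GDERIV F z :> F' z"
    and C1: "continuous_on UNIV F'"
    and lipschitz: "\<exists>l_F<b. \<forall>z h. norm (F' (z + h) - F' z) \<le> l_F * norm h"
    and asymptotic: "\<exists>M>0. \<exists>B_inf\<in>L_s b. \<exists>r.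
          (\<forall>z. F' z = B_inf z + r z \<and> norm (r z) \<le> M) \<and>
          (filterlim (\<lambda>z. inner (r z) z) at_top at_infinity \<or>
           filterlim (\<lambda>z. inner (r z) z) at_bot at_infinity)"
  shows "\<exists>z\<in>D. A z = F' z"
proof -
  have sa: "self_adjoint D A" and ess: "essential_spectrum D A \<inter> {-b<..<b} = {}"
    using A by (auto simp: O0e_def)
  obtain l_F where l_F: "l_F < b" "\<And>z h. norm (F' (z + h) - F' z) \<le> l_F * norm h"
    using lipschitz by blast
  obtain M B r where B: "B \<in> L_s b" and r: "\<And>z. F' z = B z + r z" "\<And>z. norm (r z) \<le> M"
    and lim: "filterlim (\<lambda>z. inner (r z) z) at_top at_infinity \<or>
      filterlim (\<lambda>z. inner (r z) z) at_bot at_infinity"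
    using asymptotic by blast
  obtain \<rho> where \<rho>: "0 \<le> \<rho>" "\<rho> < b" "\<And>x. norm (B x) \<le> \<rho> * norm x"
    using L_s_norm_bound[OF B b] by blast
  define l where "l = max 0 l_F"
  have l: "0 \<le> l" "l < b" using l_F(1) b by (auto simp: l_def)
  have F_lip: "norm (F' x - F' y) \<le> l * norm (x - y)" for x y
    using l_F(2)[of y "x - y"] mult_right_mono[of l_F l "norm (x - y)"] by (simp add: l_def)
  obtain \<beta> where between: "max l \<rho> < \<beta>" "\<beta> < b" using l(2) \<rho>(2) dense[of "max l \<rho>" b] by auto
  have \<beta>_pos: "0 < \<beta>" using between(1) l(1) by simp
  obtain K S where KS: "bounded_linear K" "finite_dimensional (range K)" "bounded_linear S"
    "\<And>y. S y \<in> D" "\<And>y. A (S y) + K (S y) = y" "\<And>x. x \<in> D \<Longrightarrow> S (A x + K x) = x"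
    "\<And>y. norm (S y) \<le> norm y / \<beta>"
    using finite_rank_modified_inverse[OF sa \<beta>_pos between(2) ess] by blast
  interpret modified_inverse D A K S \<beta>
    by (intro modified_inverse.intro sa KS \<beta>_pos)
  have B_bl: "bounded_linear B" using B by (simp add: L_s_def)
  \<comment> \<open>The sign merges the two asymptotic cases into one coercivity condition.\<close>
  obtain \<sigma> :: real where \<sigma>: "\<sigma> = 1 \<or> \<sigma> = -1"
    "filterlim (\<lambda>z. \<sigma> * inner (r z) z) at_top at_infinity"
  proof (cases "filterlim (\<lambda>z. inner (r z) z) at_top at_infinity")
    case True
    then show ?thesis using that[of 1] by simp
  next
    case False
    then have "filterlim (\<lambda>z. - inner (r z) z) at_top at_infinity"
      using lim by (simp add: filterlim_uminus_at_top)
    then show ?thesis using that[of "-1"] by simp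
  qed
  have "\<rho> < \<beta>" "l < \<beta>" using between(1) by auto
  then show ?thesis
    using semilinear_solvable[OF B_bl L_s_symmetric[OF B] \<rho>(1) _ \<rho>(3) F_lip l(1) _ r \<sigma>] by blast
qed

end
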